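(* Let $d\in\left[-\frac34,0\right]$ and $x,y\in\mathbb{R}$. A necessary and sufficient condition for $\sigma=(1,x,y,d-x-y,-d-1)$ to be a normalized spectrum of some trace zero symmetric (entrywise) nonnegative $5\times5$ matrix is: (a) $(x,y)$ lies within the triangle $ABC$, if $d\in\left[-\frac34,-\frac12\right]$; (b) $(x,y)$ lies within the quadrangle $ABFG$, if $d\in\left[-\frac12,-\frac34+\frac{\sqrt5}{4}\right]$; (c) $(x,y)$ lies within the region $P$, if $d\in\left[-\frac34+\frac{\sqrt5}{4},0\right]$. Here the points $A,B,C,F,G$ and the region $P$ (all depending on $d$) are as defined in the context.
   Context: A spectrum $\sigma=(\lambda_1,\dots,\lambda_5)$ of a $5\times 5$ matrix with real eigenvalues is listed with multiplicity; it is called normalized if $1=\lambda_1\ge\lambda_2\ge\lambda_3\ge\lambda_4\ge\lambda_5\ge-1$. Nonnegative matrix means entrywise nonnegative. For given $d$, define the following points in the $xy$-plane: $A=\left(\tfrac13 d,\tfrac13 d\right)$, $B=\left(d+\tfrac12,d+\tfrac12\right)$, $C=(3d+2,-d-1)$, $F=(d+1,d)$, $G=\left(d+1,-\tfrac12\right)$, $H=(f(d),f(d))$, $I=\left(d+\tfrac12+g(d),\,d+\tfrac12-g(d)\right)$, where (with real cube roots) $$f(d)=\frac23 d-\frac{\sqrt[3]{4}\,d^2}{3\sqrt[3]{r(d)}}-\frac{\sqrt[3]{r(d)}}{3\sqrt[3]{4}},$$ $$r(d)=4d^3+27d^2+27d+3\sqrt3\sqrt{d^2(d+1)(8d^2+27d+27)},$$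 $$g(d)=\sqrt{\frac{\left(d-\left(-\frac34+\frac{\sqrt5}4\right)\right)\left(d-\left(-\frac34-\frac{\sqrt5}4\right)\right)}{2d+1}}.$$ For $d\in\left[-\frac34+\frac{\sqrt5}4,0\right]$, $P$ is the (closed) 5-vertex shape $AHIFG$, whose edges $AH$, $IF$, $FG$, $GA$ are straight segments and whose edge $HI$ is the curve $\gamma(t)=(x(t),h(x(t)))$, $t\in[0,1]$, with $x(t)=(1-t)f(d)+t\left(d+\frac12+g(d)\right)$ and $$h(t)=-\frac12(t-d)+\frac12\sqrt{\frac{t^3+dt^2-d^2t-4d-4d^2-d^3}{t-d}}.$$ (One has $\gamma(0)=H$ and $\gamma(1)=I$.) For $d=0$, the formulas are understood in the limit: $f(0)=0$ and $h(t)=0$ for $t\ge0$, so $P$ is the triangle with vertices $(0,0)$, $(1,0)$, $\left(1,-\frac12\right)$. All triangles, quadrangles and shapes are closed regions (boundary included) and may be degenerate (e.g. for $d=-\frac34$ the triangle $ABC$ is a single point). *)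

theory Defs
  imports "HOL-Analysis.Analysis" "Jordan_Normal_Form.Char_Poly"
begin

section \<open>Spectra of symmetric nonnegative matrices\<close>

definition nonneg_entries :: "real mat \<Rightarrow> bool" where
  "nonneg_entries M \<longleftrightarrow> (\<forall>i<dim_row M. \<forall>j<dim_col M. 0 \<le> M $$ (i, j))"

definition mat_trace :: "real mat \<Rightarrow> real" where
  "mat_trace M = (\<Sum>i<dim_row M. M $$ (i, i))"

text \<open>All eigenvalues of \<open>M\<close> are real and \<open>\<sigma>\<close> lists them with algebraic multiplicity.\<close>

definition has_spectrum :: "real mat \<Rightarrow> real list \<Rightarrow> bool" where
  "has_spectrum M \<sigma> \<longleftrightarrow> char_poly M = (\<Prod>l\<leftarrow>\<sigma>. [:- l, 1:])"

text \<open>The given order of the list matters: the entries have to be listed in decreasing order.\<close>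

definition normalized :: "real list \<Rightarrow> bool" where
  "normalized \<sigma> \<longleftrightarrow>
     length \<sigma> = 5 \<and> hd \<sigma> = 1 \<and> sorted_wrt (\<ge>) \<sigma> \<and> last \<sigma> \<ge> -1"

definition normalized_realizable :: "real list \<Rightarrow> bool" where
  "normalized_realizable \<sigma> \<longleftrightarrow> normalized \<sigma> \<and>
     (\<exists>M \<in> carrier_mat 5 5. transpose_mat M = M \<and> nonneg_entries M \<and> mat_trace M = 0 \<and>
        has_spectrum M \<sigma>)"

section \<open>The points and the curve\<close>

text \<open>\<^term>\<open>root 3\<close> is the real cube root, also for negative arguments.\<close>

definition r_fun :: "real \<Rightarrow> real" where
  "r_fun d = 4 * d^3 + 27 * d^2 + 27 * d
     + 3 * sqrt 3 * sqrt (d^2 * (d + 1) * (8 * d^2 + 27 * d + 27))"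

definition f_fun :: "real \<Rightarrow> real" where
  "f_fun d = 2/3 * d - root 3 4 * d^2 / (3 * root 3 (r_fun d)) - root 3 (r_fun d) / (3 * root 3 4)"

definition g_fun :: "real \<Rightarrow> real" where
  "g_fun d = sqrt ((d - (-3/4 + sqrt 5 / 4)) * (d - (-3/4 - sqrt 5 / 4)) / (2 * d + 1))"

definition h_fun :: "real \<Rightarrow> real \<Rightarrow> real" where
  "h_fun d t = - 1/2 * (t - d)
     + 1/2 * sqrt ((t^3 + d * t^2 - d^2 * t - 4 * d - 4 * d^2 - d^3) / (t - d))"

text \<open>For \<open>d = 0\<close> the convention \<open>x / 0 = 0\<close> yields the limit values, so no case
  distinction is needed.\<close>

lemma f_fun_0: "f_fun 0 = 0"
  by (simp add: f_fun_def r_fun_def)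

lemma h_fun_0:
  assumes "t \<ge> 0" shows "h_fun 0 t = 0"
proof -
  have "t ^ 3 / t = t\<^sup>2"
    by (simp add: power3_eq_cube power2_eq_square)
  then show ?thesis using assms by (simp add: h_fun_def)
qed

definition pt_A :: "real \<Rightarrow> real \<times> real" where
  "pt_A d = (1/3 * d, 1/3 * d)"

definition pt_B :: "real \<Rightarrow> real \<times> real" where
  "pt_B d = (d + 1/2, d + 1/2)"

definition pt_C :: "real \<Rightarrow> real \<times> real" where
  "pt_C d = (3 * d + 2, - d - 1)"

definition pt_F :: "real \<Rightarrow> real \<times> real" where
  "pt_F d = (d + 1, d)"

definition pt_G :: "real \<Rightarrow> real \<times> real" where
  "pt_G d = (d + 1, - 1/2)"

definition pt_H :: "real \<Rightarrow> real \<times> real" where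
  "pt_H d = (f_fun d, f_fun d)"

definition pt_I :: "real \<Rightarrow> real \<times> real" where
  "pt_I d = (d + 1/2 + g_fun d, d + 1/2 - g_fun d)"

definition x_curve :: "real \<Rightarrow> real \<Rightarrow> real" where
  "x_curve d t = (1 - t) * f_fun d + t * (d + 1/2 + g_fun d)"

definition gamma_curve :: "real \<Rightarrow> real \<Rightarrow> real \<times> real" where
  "gamma_curve d t = (x_curve d t, h_fun d (x_curve d t))"

section \<open>The regions\<close>

definition triangle_ABC :: "real \<Rightarrow> (real \<times> real) set" where
  "triangle_ABC d = convex hull {pt_A d, pt_B d, pt_C d}"

text \<open>For \<open>-1/2 \<le> d \<le> -3/4 + sqrt 5 / 4\<close> the points \<open>A, B, F, G\<close> are, in this order, the
  vertices of a (possibly degenerate) convex quadrangle: the edge vectors \<open>AB, BF, FG, GA\<close> are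
  nonnegative multiples of \<open>(1, 1), (1, -1), (0, -1), (-2, 1)\<close>, so the boundary always turns
  clockwise.\<close>

definition quadrangle_ABFG :: "real \<Rightarrow> (real \<times> real) set" where
  "quadrangle_ABFG d = convex hull {pt_A d, pt_B d, pt_F d, pt_G d}"

text \<open>The shape \<open>P\<close> is in general not convex, as the edge \<open>HI\<close> bends inwards.\<close>

definition boundary_P :: "real \<Rightarrow> real \<Rightarrow> real \<times> real" where
  "boundary_P d =
     linepath (pt_A d) (pt_H d) +++ gamma_curve d +++ linepath (pt_I d) (pt_F d) +++
     linepath (pt_F d) (pt_G d) +++ linepath (pt_G d) (pt_A d)"

definition region_P :: "real \<Rightarrow> (real \<times> real) set" where
  "region_P d = path_image (boundary_P d) \<union> inside (path_image (boundary_P d))"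

end

theory Submission
  imports Defs
begin

text \<open>
  Write the spectrum as \<open>(1, x, y, z, - d - 1)\<close> with \<open>z = d - x - y\<close>. Three conditions are
  necessary for it to belong to a symmetric nonnegative matrix \<open>M\<close> of trace zero. The listed order
  gives the inequalities \<open>z \<le> y \<le> x\<close> and \<open>- d - 1 \<le> z\<close>. The trace of \<open>M\<^sup>3\<close>, which is the
  sum of the cubes of the eigenvalues, is nonnegative; as the eigenvalues sum to zero, this says that
  \<open>cubic d x y = (x + y) (x - d) (y - d) + d (1 + d)\<close> is at most \<open>0\<close>. Finally the second
  eigenvalue and the last one have a nonpositive sum (\<open>second_plus_last_eigenvalue_nonpos\<close>), that is
  \<open>x \<le> d + 1\<close>. The set of all \<open>(x, y)\<close> with these properties is \<open>spectral_region d\<close>.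

  The conditions are also sufficient (\<open>normalized_realizable_iff_spectral_region\<close>). Every spectrum in
  the region is realized by a matrix that commutes with the reflection of five points that fixes one
  of them and swaps the other four in pairs. Such a matrix splits into a block of size \<open>3\<close> on the
  symmetric vectors and a block of size \<open>2\<close> on the antisymmetric ones, so its characteristic
  polynomial is the product of an explicit cubic and an explicit quadratic polynomial, whose
  coefficients can be matched with the wanted eigenvalues. If \<open>y \<le> 0\<close>, the blocks carry
  \<open>{1, x, z}\<close> and \<open>{y, - d - 1}\<close>. If \<open>y > 0\<close>, they carry \<open>{1, y, z}\<close> and
  \<open>{x, - d - 1}\<close>, and nonnegativity of the remaining weight is exactly the condition on the cubic.

  It remains to identify the region for the various \<open>d\<close>. For \<open>d \<le> -1/2\<close> the order of the eigenvalues
  alone forces \<open>x \<le> d + 1\<close> and \<open>y \<le> 0\<close>, and for \<open>y \<le> 0\<close> the cubic is automatically nonpositive. For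
  \<open>-1/2 \<le> d \<le> -3/4 + sqrt 5 / 4\<close> an arithmetic-geometric estimate shows that the cubic is still
  nonpositive. For larger \<open>d\<close> the curve \<open>cubic d x y = 0\<close> cuts off the corner \<open>B\<close> of the quadrangle.
  It meets the line \<open>y = x\<close> in \<open>H\<close>, by Cardano's formula, and the line \<open>x + y = 2 d + 1\<close> in \<open>I\<close>,
  and between these points it is the graph of \<open>h_fun d\<close>. That the closed outline together with its
  inside is the region needs no theorem on Jordan curves: a bounded set \<open>S\<close> is the union of \<open>B\<close> and the
  inside of \<open>B\<close> for every \<open>B \<subseteq> S\<close> that contains the frontier of \<open>S\<close>, provided that from each point
  outside \<open>S\<close> a ray runs to infinity without meeting \<open>S\<close> (\<open>outline_union_inside\<close>).
\<close>

section \<open>The realizable region\<close>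

text \<open>Up to the factor \<open>-3\<close> this is the sum of the cubes of the five eigenvalues, see
  \<open>sum_of_cubes_eq_cubic\<close> below.\<close>

definition cubic :: "real \<Rightarrow> real \<Rightarrow> real \<Rightarrow> real" where
  "cubic d x y = (x + y) * (x - d) * (y - d) + d * (1 + d)"

definition spectral_region :: "real \<Rightarrow> (real \<times> real) set" where
  "spectral_region d = {(x, y). y \<le> x \<and> d \<le> x + 2 * y \<and> x + y \<le> 2 * d + 1 \<and>
     x \<le> d + 1 \<and> cubic d x y \<le> 0}"

section \<open>Diagonalizing real symmetric matrices\<close>

text \<open>The reflection in the hyperplane orthogonal to \<open>v - e\<^sub>0\<close> swaps \<open>v\<close> and the first unit vector
  \<open>e\<^sub>0\<close>, so its first column is \<open>v\<close>.\<close>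

lemma householder_reflection:
  fixes v :: "real vec"
  assumes v: "v \<in> carrier_vec n" and n: "0 < n" and unit: "v \<bullet> v = 1"
  shows "\<exists>W \<in> carrier_mat n n. W\<^sup>T = W \<and> W * W = 1\<^sub>m n \<and> col W 0 = v"
proof -
  define u where "u i = v $ i - (if i = 0 then 1 else 0)" for i
  \<comment> \<open>For \<open>v = e\<^sub>0\<close> the denominator is \<open>0\<close>; then \<open>c = 0\<close> and \<open>W\<close> is the identity, as it should be.\<close>
  define c where "c = 1 / (1 - v $ 0)"
  define W where "W = mat n n (\<lambda>(i, j). (if i = j then 1 else 0) - c * u i * u j)"
  have v2: "(\<Sum>k\<in>{0..<n}. v $ k * v $ k) = 1"
    using unit v by (simp add: scalar_prod_def)
  have u2: "(\<Sum>k\<in>{0..<n}. u k * u k) = 2 * (1 - v $ 0)"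
  proof -
    have "(\<Sum>k\<in>{0..<n}. u k * u k)
        = (\<Sum>k\<in>{0..<n}. v $ k * v $ k + (if k = 0 then 1 - 2 * v $ 0 else 0))"
      by (rule sum.cong) (auto simp: u_def algebra_simps)
    also have "\<dots> = 1 + (1 - 2 * v $ 0)"
      using n by (simp add: sum.distrib v2)
    finally show ?thesis by simp
  qed
  have cu: "c * (1 - v $ 0) * u i = u i" if "i < n" for i
  proof (cases "v $ 0 = 1")
    case True
    then have "(\<Sum>k\<in>{0..<n}. u k * u k) = 0" using u2 by simp
    then have "u i * u i = 0"
      using that by (subst (asm) sum_nonneg_eq_0_iff) auto
    then show ?thesis by simp
  next
    case False then show ?thesis by (simp add: c_def)
  qed
  have W: "W \<in> carrier_mat n n" by (simp add: W_def)
  have WT: "W\<^sup>T = W"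
    by (rule eq_matI) (auto simp: W_def)
  have WW: "W * W = 1\<^sub>m n"
  proof (rule eq_matI)
    fix i j assume "i < dim_row (1\<^sub>m n)" "j < dim_col (1\<^sub>m n)"
    then have i: "i < n" and j: "j < n" by auto
    have "(W * W) $$ (i, j) = (\<Sum>k\<in>{0..<n}. W $$ (i, k) * W $$ (k, j))"
      using i j W by (simp add: scalar_prod_def)
    also have "\<dots> = (\<Sum>k\<in>{0..<n}. (if k = i then (if i = j then 1 else 0) - c * u i * u j else 0)
        - (if k = j then c * u i * u j else 0) + c * c * u i * u j * (u k * u k))"
      by (rule sum.cong) (use i j in \<open>auto simp: W_def algebra_simps\<close>)
    also have "\<dots> = (if i = j then 1 else 0) - 2 * (c * u i * u j)
        + c * c * u i * u j * (2 * (1 - v $ 0))"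
      using i j by (simp add: sum.distrib sum_subtractf sum_distrib_left[symmetric] u2)
    also have "c * c * u i * u j * (2 * (1 - v $ 0)) = 2 * c * u j * (c * (1 - v $ 0) * u i)"
      by (simp add: algebra_simps)
    also have "\<dots> = 2 * (c * u i * u j)"
      by (simp add: cu[OF i])
    finally show "(W * W) $$ (i, j) = 1\<^sub>m n $$ (i, j)" using i j by simp
  qed (use W in auto)
  have "col W 0 = v"
  proof (rule eq_vecI)
    fix i assume "i < dim_vec v"
    then have i: "i < n" using v by simp
    have "col W 0 $ i = (if i = 0 then 1 else 0) + c * (1 - v $ 0) * u i"
      using i n by (simp add: W_def u_def algebra_simps)
    then show "col W 0 $ i = v $ i" unfolding cu[OF i] by (simp add: u_def)
  qed (use W v in auto)
  with W WT WW show ?thesis by blast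
qed

text \<open>By induction on the list of eigenvalues: a reflection moves a unit eigenvector for the head of the
  list to the first unit vector, and the conjugated matrix, being symmetric, decomposes into this
  eigenvalue and a smaller symmetric block, whose characteristic polynomial belongs to the tail.\<close>

lemma real_symmetric_diagonalization:
  fixes A :: "real mat"
  assumes "A \<in> carrier_mat n n" "A\<^sup>T = A" "char_poly A = (\<Prod>l\<leftarrow>es. [:- l, 1:])"
  shows "\<exists>P \<in> carrier_mat n n. P\<^sup>T * P = 1\<^sub>m n \<and>
    P\<^sup>T * A * P = mat n n (\<lambda>(i, j). if i = j then es ! i else 0)"
  using assms
proof (induction es arbitrary: n A)
  case Nil
  then have "n = 0" using degree_monic_char_poly[of A n] by simp
  then show ?case using Nil by (intro bexI[of _ "1\<^sub>m 0"]) auto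
next
  case (Cons e es n A)
  note A = Cons.prems(1)
  have "degree (char_poly A) = Suc (length es)"
    unfolding Cons.prems(3) using degree_linear_factors[of uminus "e # es"] by simp
  then obtain m where n: "n = Suc m" using degree_monic_char_poly[OF A] by auto
  have "eigenvalue A e"
    unfolding eigenvalue_root_char_poly[OF A] Cons.prems(3) by simp
  then obtain w where w: "w \<in> carrier_vec n" "w \<noteq> 0\<^sub>v n" "A *\<^sub>v w = e \<cdot>\<^sub>v w"
    using A unfolding eigenvalue_def eigenvector_def by auto
  have ww: "w \<bullet> w > 0"
    using conjugate_square_greater_0_vec[OF w(1)] w(2) by simp
  define v where "v = (1 / sqrt (w \<bullet> w)) \<cdot>\<^sub>v w"
  have v: "v \<in> carrier_vec n" and Av: "A *\<^sub>v v = e \<cdot>\<^sub>v v"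
    using w A by (auto simp: v_def mult_mat_vec smult_smult_assoc mult.commute)
  have vv: "v \<bullet> v = 1" using w ww by (simp add: v_def field_simps)
  obtain W where W: "W \<in> carrier_mat n n" and WT: "W\<^sup>T = W" and WW: "W * W = 1\<^sub>m n"
    and W0: "col W 0 = v"
    using householder_reflection[OF v _ vv] n by auto
  define A' where "A' = W * A * W"
  have A': "A' \<in> carrier_mat n n" using W A by (simp add: A'_def)
  have A'T: "A'\<^sup>T = A'"
    unfolding A'_def using W A WT Cons.prems(2)
    by (simp add: transpose_mult[of _ n n _ n] assoc_mult_mat[of _ n n _ n _ n])
  have "col A' 0 = W * A *\<^sub>v v"
    unfolding A'_def W0[symmetric] using W A n by (subst col_mult2[of _ n n _ n]) auto
  also have "\<dots> = W *\<^sub>v (A *\<^sub>v v)" using W A v by (rule assoc_mult_mat_vec)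
  also have "\<dots> = e \<cdot>\<^sub>v (W *\<^sub>v v)" using W v by (simp add: Av mult_mat_vec)
  also have "W *\<^sub>v v = col (W * W) 0"
    unfolding W0[symmetric] using W n by (subst col_mult2[of _ n n _ n]) auto
  finally have col0: "col A' 0 = e \<cdot>\<^sub>v unit_vec n 0" using n by (simp add: WW)
  have A'0: "A' $$ (i, 0) = (if i = 0 then e else 0)" if "i < n" for i
    using arg_cong[OF col0, of "\<lambda>v. v $ i"] that A' n by auto
  have A'0': "A' $$ (0, i) = (if i = 0 then e else 0)" if "i < n" for i
  proof -
    have "A' $$ (0, i) = A'\<^sup>T $$ (i, 0)" using that A' n by auto
    with A'T A'0[OF that] show ?thesis by simp
  qed
  define A1 where "A1 = mat 1 1 (\<lambda>_. e)"
  define A3 where "A3 = mat m m (\<lambda>(i, j). A' $$ (Suc i, Suc j))"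
  have A1: "A1 \<in> carrier_mat 1 1" and A3: "A3 \<in> carrier_mat m m"
    by (auto simp: A1_def A3_def)
  have block: "A' = four_block_mat A1 (0\<^sub>m 1 m) (0\<^sub>m m 1) A3"
    by (rule eq_matI) (use A' n A'0 A'0' in \<open>auto simp: A1_def A3_def\<close>)
  have A3T: "A3\<^sup>T = A3"
  proof (rule eq_matI)
    fix i j assume "i < dim_row A3" "j < dim_col A3"
    then have "i < m" "j < m" using A3 by auto
    moreover from this have "A' $$ (Suc j, Suc i) = A'\<^sup>T $$ (Suc i, Suc j)"
      using A' n by auto
    ultimately show "A3\<^sup>T $$ (i, j) = A3 $$ (i, j)" by (simp add: A3_def A'T)
  qed (use A3 in auto)
  have "similar_mat_wit A' A W W"
    by (rule similar_mat_witI[of _ _ n]) (use W A A' WW in \<open>auto simp: A'_def\<close>)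
  then have "char_poly A' = char_poly A"
    by (intro char_poly_similar) (auto simp: similar_mat_def)
  moreover have "char_poly A' = char_poly A1 * char_poly A3"
    unfolding block by (rule char_poly_four_block_zeros_col[OF A1 _ A3]) simp
  moreover have "char_poly A1 = [:- e, 1:]"
    by (simp add: A1_def char_poly_defs det_def sign_def)
  ultimately have "char_poly A3 = (\<Prod>l\<leftarrow>es. [:- l, 1:])"
    using Cons.prems(3) by (simp del: mult_pCons_left)
  from Cons.IH[OF A3 A3T this] obtain P where P: "P \<in> carrier_mat m m"
    and PP: "P\<^sup>T * P = 1\<^sub>m m"
    and PAP: "P\<^sup>T * A3 * P = mat m m (\<lambda>(i, j). if i = j then es ! i else 0)" by auto
  define Q where "Q = four_block_mat (1\<^sub>m 1) (0\<^sub>m 1 m) (0\<^sub>m m 1) P"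
  have Q: "Q \<in> carrier_mat n n" using P by (auto simp: Q_def n)
  have QT: "Q\<^sup>T = four_block_mat (1\<^sub>m 1) (0\<^sub>m 1 m) (0\<^sub>m m 1) P\<^sup>T"
    unfolding Q_def using P by (subst transpose_four_block_mat[of _ 1 1 _ m _ m]) auto
  have QQ: "Q\<^sup>T * Q = 1\<^sub>m n"
    unfolding QT unfolding Q_def
    by (subst mult_four_block_mat[of _ 1 1 _ m _ m _ _ 1 _ m])
      (use P PP n in \<open>auto simp: four_block_one_mat[symmetric]\<close>)
  have "Q\<^sup>T * A' = four_block_mat A1 (0\<^sub>m 1 m) (0\<^sub>m m 1) (P\<^sup>T * A3)"
    unfolding QT block
    by (subst mult_four_block_mat[of _ 1 1 _ m _ m _ _ 1 _ m]) (use P A1 A3 in auto)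
  then have "Q\<^sup>T * A' * Q = four_block_mat A1 (0\<^sub>m 1 m) (0\<^sub>m m 1) (P\<^sup>T * A3 * P)"
    unfolding Q_def
    by (simp, subst mult_four_block_mat[of _ 1 1 _ m _ m _ _ 1 _ m]) (use P A1 A3 in auto)
  also have "\<dots> = mat n n (\<lambda>(i, j). if i = j then (e # es) ! i else 0)"
    unfolding PAP by (rule eq_matI) (auto simp: A1_def n)
  finally have QAQ: "Q\<^sup>T * A' * Q = mat n n (\<lambda>(i, j). if i = j then (e # es) ! i else 0)" .
  have WQT: "(W * Q)\<^sup>T = Q\<^sup>T * W" using transpose_mult[OF W Q] WT by simp
  have "(W * Q)\<^sup>T * (W * Q) = Q\<^sup>T * (W * W) * Q"
    unfolding WQT using W Q by (simp add: assoc_mult_mat[of _ n n _ n _ n])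
  then have 1: "(W * Q)\<^sup>T * (W * Q) = 1\<^sub>m n" using Q QQ by (simp add: WW)
  have "(W * Q)\<^sup>T * A * (W * Q) = Q\<^sup>T * A' * Q"
    unfolding WQT A'_def using W Q A by (simp add: assoc_mult_mat[of _ n n _ n _ n])
  with 1 QAQ W Q show ?case by (intro bexI[of _ "W * Q"]) auto
qed

section \<open>Orthonormal eigenbases\<close>

text \<open>\<open>u k i\<close> is the \<open>i\<close>-th coordinate of the \<open>k\<close>-th eigenvector, belonging to the eigenvalue \<open>c k\<close>. The
  matrix is a function, so that the arguments below are manipulations of finite sums.\<close>

definition eigenbasis :: "nat \<Rightarrow> (nat \<Rightarrow> nat \<Rightarrow> real) \<Rightarrow> (nat \<Rightarrow> real) \<Rightarrow> (nat \<Rightarrow> nat \<Rightarrow> real) \<Rightarrow> bool"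
  where "eigenbasis n m c u \<longleftrightarrow>
    (\<forall>k<n. \<forall>l<n. (\<Sum>i<n. u k i * u l i) = (if k = l then 1 else 0)) \<and>
    (\<forall>i<n. \<forall>j<n. (\<Sum>k<n. u k i * u k j) = (if i = j then 1 else 0)) \<and>
    (\<forall>i<n. \<forall>j<n. m i j = (\<Sum>k<n. c k * u k i * u k j))"

lemma eigenbasis_orthonormal:
  "eigenbasis n m c u \<Longrightarrow> k < n \<Longrightarrow> l < n \<Longrightarrow> (\<Sum>i<n. u k i * u l i) = (if k = l then 1 else 0)"
  by (simp add: eigenbasis_def)

lemma eigenbasis_complete:
  "eigenbasis n m c u \<Longrightarrow> i < n \<Longrightarrow> j < n \<Longrightarrow> (\<Sum>k<n. u k i * u k j) = (if i = j then 1 else 0)"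
  by (simp add: eigenbasis_def)

lemma eigenbasis_decomposition:
  "eigenbasis n m c u \<Longrightarrow> i < n \<Longrightarrow> j < n \<Longrightarrow> m i j = (\<Sum>k<n. c k * u k i * u k j)"
  by (simp add: eigenbasis_def)

lemma eigenbasis_exists:
  fixes M :: "real mat"
  assumes M: "M \<in> carrier_mat n n" and sym: "M\<^sup>T = M" and spec: "has_spectrum M \<sigma>"
  shows "\<exists>u. eigenbasis n (\<lambda>i j. M $$ (i, j)) (\<lambda>k. \<sigma> ! k) u"
proof -
  define D where "D = mat n n (\<lambda>(i, j). if i = j then \<sigma> ! i else 0)"
  obtain P where P: "P \<in> carrier_mat n n" and PP: "P\<^sup>T * P = 1\<^sub>m n" and PMP: "P\<^sup>T * M * P = D"
    using real_symmetric_diagonalization[OF M sym] spec by (auto simp: has_spectrum_def D_def)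
  have PP': "P * P\<^sup>T = 1\<^sub>m n"
    using mat_mult_left_right_inverse[of "P\<^sup>T" n P] P PP by auto
  have D: "D \<in> carrier_mat n n" by (simp add: D_def)
  have "P * D * P\<^sup>T = (P * P\<^sup>T) * M * (P * P\<^sup>T)"
    unfolding PMP[symmetric] using P M by (simp add: assoc_mult_mat[of _ n n _ n _ n])
  then have M_eq: "M = P * D * P\<^sup>T" using M by (simp add: PP')
  have PD: "(P * D) $$ (i, k) = P $$ (i, k) * \<sigma> ! k" if "i < n" "k < n" for i k
  proof -
    have "(P * D) $$ (i, k) = (\<Sum>l\<in>{0..<n}. P $$ (i, l) * D $$ (l, k))"
      using that P D by (simp add: scalar_prod_def)
    also have "\<dots> = (\<Sum>l\<in>{0..<n}. if l = k then P $$ (i, k) * \<sigma> ! k else 0)"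
      using that by (intro sum.cong) (auto simp: D_def)
    finally show ?thesis using that by simp
  qed
  have "(\<Sum>i<n. P $$ (i, k) * P $$ (i, l)) = (if k = l then 1 else 0)" if "k < n" "l < n" for k l
    using arg_cong[OF PP, of "\<lambda>A. A $$ (k, l)"] that P
    by (simp add: scalar_prod_def atLeast0LessThan)
  moreover have "(\<Sum>k<n. P $$ (i, k) * P $$ (j, k)) = (if i = j then 1 else 0)"
    if "i < n" "j < n" for i j
    using arg_cong[OF PP', of "\<lambda>A. A $$ (i, j)"] that P
    by (simp add: scalar_prod_def atLeast0LessThan)
  moreover have "M $$ (i, j) = (\<Sum>k<n. \<sigma> ! k * P $$ (i, k) * P $$ (j, k))" if "i < n" "j < n" for i j
  proof -
    have "(E * P\<^sup>T) $$ (i, j) = (\<Sum>k\<in>{0..<n}. E $$ (i, k) * P $$ (j, k))"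
      if "E \<in> carrier_mat n n" for E
      using that \<open>i < n\<close> \<open>j < n\<close> P by (simp add: scalar_prod_def)
    from this[of "P * D"]
    have "M $$ (i, j) = (\<Sum>k\<in>{0..<n}. (P * D) $$ (i, k) * P $$ (j, k))"
      using P D by (subst M_eq) simp
    also have "\<dots> = (\<Sum>k\<in>{0..<n}. \<sigma> ! k * P $$ (i, k) * P $$ (j, k))"
      using that PD by (intro sum.cong) (auto simp: mult_ac)
    finally show ?thesis by (simp add: atLeast0LessThan)
  qed
  ultimately show ?thesis
    unfolding eigenbasis_def by (intro exI[of _ "\<lambda>k i. P $$ (i, k)"]) blast
qed

lemma eigenbasis_expansion:
  assumes "eigenbasis n m c u" "i < n"
  shows "(\<Sum>k<n. (\<Sum>j<n. u k j * x j) * u k i) = x i"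
proof -
  have "(\<Sum>k<n. (\<Sum>j<n. u k j * x j) * u k i) = (\<Sum>k<n. \<Sum>j<n. x j * (u k j * u k i))"
    by (simp add: sum_distrib_left sum_distrib_right mult_ac)
  also have "\<dots> = (\<Sum>j<n. \<Sum>k<n. x j * (u k j * u k i))" by (rule sum.swap)
  also have "\<dots> = (\<Sum>j<n. if j = i then x i else 0)"
    using assms eigenbasis_complete[OF assms(1)]
    by (intro sum.cong) (auto simp: sum_distrib_left[symmetric])
  finally show ?thesis using assms by simp
qed

lemma eigenbasis_apply:
  assumes "eigenbasis n m c u" "i < n"
  shows "(\<Sum>j<n. m i j * x j) = (\<Sum>k<n. c k * (\<Sum>j<n. u k j * x j) * u k i)"
proof -
  have "(\<Sum>j<n. m i j * x j) = (\<Sum>j<n. \<Sum>k<n. c k * (u k j * x j) * u k i)"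
    using eigenbasis_decomposition[OF assms]
    by (intro sum.cong refl) (simp add: sum_distrib_left sum_distrib_right mult_ac)
  also have "\<dots> = (\<Sum>k<n. \<Sum>j<n. c k * (u k j * x j) * u k i)" by (rule sum.swap)
  finally show ?thesis by (simp add: sum_distrib_left sum_distrib_right)
qed

lemma eigenbasis_eigenvector:
  assumes "eigenbasis n m c u" "i < n" "k < n"
  shows "(\<Sum>j<n. m i j * u k j) = c k * u k i"
proof -
  have "(\<Sum>j<n. m i j * u k j) = (\<Sum>l<n. if l = k then c k * u k i else 0)"
    unfolding eigenbasis_apply[OF assms(1,2)]
    by (intro sum.cong) (auto simp: eigenbasis_orthonormal[OF assms(1)] \<open>k < n\<close>)
  then show ?thesis using \<open>k < n\<close> by simp
qed

lemma eigenbasis_quadratic_form: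
  assumes "eigenbasis n m c u"
  shows "(\<Sum>i<n. \<Sum>j<n. x i * m i j * x j) = (\<Sum>k<n. c k * (\<Sum>i<n. u k i * x i)\<^sup>2)"
proof -
  have row: "x i * (\<Sum>j<n. m i j * x j) = (\<Sum>k<n. c k * (\<Sum>j<n. u k j * x j) * (u k i * x i))"
    if "i < n" for i
    unfolding eigenbasis_apply[OF assms that] by (simp add: sum_distrib_left mult_ac)
  have "(\<Sum>i<n. \<Sum>j<n. x i * m i j * x j) = (\<Sum>i<n. x i * (\<Sum>j<n. m i j * x j))"
    by (simp add: sum_distrib_left mult.assoc)
  also have "\<dots> = (\<Sum>i<n. \<Sum>k<n. c k * (\<Sum>j<n. u k j * x j) * (u k i * x i))"
    by (intro sum.cong refl row) auto
  also have "\<dots> = (\<Sum>k<n. \<Sum>i<n. c k * (\<Sum>j<n. u k j * x j) * (u k i * x i))" by (rule sum.swap)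
  finally show ?thesis by (simp add: sum_distrib_left[symmetric] power2_eq_square mult.assoc)
qed

lemma eigenbasis_parseval:
  assumes "eigenbasis n m c u"
  shows "(\<Sum>k<n. (\<Sum>i<n. u k i * x i)\<^sup>2) = (\<Sum>i<n. (x i)\<^sup>2)"
proof -
  have "(\<Sum>k<n. (\<Sum>i<n. u k i * x i)\<^sup>2) = (\<Sum>k<n. \<Sum>i<n. (\<Sum>j<n. u k j * x j) * u k i * x i)"
    by (simp add: power2_eq_square sum_distrib_left mult.assoc)
  also have "\<dots> = (\<Sum>i<n. \<Sum>k<n. (\<Sum>j<n. u k j * x j) * u k i * x i)" by (rule sum.swap)
  also have "\<dots> = (\<Sum>i<n. x i * x i)"
    by (intro sum.cong refl) (simp add: sum_distrib_right[symmetric] eigenbasis_expansion[OF assms])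
  finally show ?thesis by (simp add: power2_eq_square)
qed

text \<open>Products of matrices with a common eigenbasis are computed on the eigenvalues; this gives access to
  the trace of \<open>M\<^sup>3\<close>.\<close>

lemma eigenbasis_mult:
  assumes u: "eigenbasis n m c u" and u': "eigenbasis n m' c' u"
  shows "eigenbasis n (\<lambda>i l. \<Sum>j<n. m i j * m' j l) (\<lambda>k. c k * c' k) u"
proof -
  have "(\<Sum>j<n. m i j * m' j l) = (\<Sum>k<n. c k * c' k * u k i * u k l)" if i: "i < n" and l: "l < n" for i l
  proof -
    have "(\<Sum>j<n. u k j * m' j l) = c' k * u k l" if "k < n" for k
    proof -
      have "(\<Sum>j<n. u k j * m' j l) = (\<Sum>j<n. m' l j * u k j)"
        using l by (intro sum.cong) (auto simp: eigenbasis_decomposition[OF u'] mult_ac)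
      then show ?thesis using eigenbasis_eigenvector[OF u' l that] by simp
    qed
    then show ?thesis
      unfolding eigenbasis_apply[OF u i] by (intro sum.cong) (auto simp: mult_ac)
  qed
  with u show ?thesis by (simp add: eigenbasis_def)
qed

lemma eigenbasis_trace:
  assumes "eigenbasis n m c u"
  shows "(\<Sum>i<n. m i i) = (\<Sum>k<n. c k)"
proof -
  have "(\<Sum>i<n. m i i) = (\<Sum>i<n. \<Sum>k<n. c k * (u k i * u k i))"
    by (intro sum.cong refl) (simp add: eigenbasis_decomposition[OF assms] mult.assoc)
  also have "\<dots> = (\<Sum>k<n. \<Sum>i<n. c k * (u k i * u k i))" by (rule sum.swap)
  also have "\<dots> = (\<Sum>k<n. c k)"
    by (intro sum.cong refl) (simp add: sum_distrib_left[symmetric] eigenbasis_orthonormal[OF assms])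
  finally show ?thesis .
qed

text \<open>The sum is the trace of \<open>M\<^sup>3\<close>, a sum of products of entries of \<open>M\<close>.\<close>

lemma sum_cubes_eigenvalues_nonneg:
  fixes M :: "real mat"
  assumes M: "M \<in> carrier_mat n n" and sym: "M\<^sup>T = M"
    and nonneg: "nonneg_entries M" and spec: "has_spectrum M \<sigma>"
  shows "0 \<le> (\<Sum>k<n. (\<sigma> ! k) ^ 3)"
proof -
  define m where "m i j = M $$ (i, j)" for i j
  have m: "0 \<le> m i j" if "i < n" "j < n" for i j
    using nonneg M that by (auto simp: nonneg_entries_def m_def)
  obtain u where u: "eigenbasis n m (\<lambda>k. \<sigma> ! k) u"
    using eigenbasis_exists[OF M sym spec] unfolding m_def by blast
  have "0 \<le> (\<Sum>i<n. \<Sum>j<n. m i j * (\<Sum>l<n. m j l * m l i))"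
    using m by (auto intro!: sum_nonneg mult_nonneg_nonneg)
  also have "\<dots> = (\<Sum>k<n. \<sigma> ! k * (\<sigma> ! k * \<sigma> ! k))"
    by (rule eigenbasis_trace[OF eigenbasis_mult[OF u eigenbasis_mult[OF u u]]])
  finally show ?thesis by (simp add: power3_eq_cube mult.assoc)
qed

section \<open>The second and the last eigenvalue\<close>

text \<open>At the larger of its at most two nonzero entries, a vector that the matrix stretches by at least
  \<open>\<mu>\<close> receives a contribution from the other entry only, because the diagonal vanishes. The matrix
  entry linking the two positions must therefore be at least \<open>\<mu>\<close>.\<close>

lemma large_entry_of_small_support:
  fixes m :: "nat \<Rightarrow> nat \<Rightarrow> real" and s :: "nat \<Rightarrow> real"
  assumes "0 < \<mu>" and m: "\<And>i j. i < n \<Longrightarrow> j < n \<Longrightarrow> 0 \<le> m i j" and diag: "\<And>i. i < n \<Longrightarrow> m i i = 0"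
    and s: "\<And>i. i < n \<Longrightarrow> 0 \<le> s i" and small: "card {i. i < n \<and> s i \<noteq> 0} \<le> 2"
    and nz: "i\<^sub>0 < n" "s i\<^sub>0 \<noteq> 0"
    and sub: "\<And>i. i < n \<Longrightarrow> s i \<noteq> 0 \<Longrightarrow> \<mu> * s i \<le> (\<Sum>j<n. m i j * s j)"
  shows "\<exists>i<n. \<exists>j<n. i \<noteq> j \<and> \<mu> \<le> m i j"
proof -
  define S where "S = {i. i < n \<and> s i \<noteq> 0}"
  have S: "finite S" "S \<noteq> {}" using nz by (auto simp: S_def)
  have "Max (s ` S) \<in> s ` S" using S by (intro Max_in) auto
  then obtain i where i: "i \<in> S" and "s i = Max (s ` S)" by auto
  then have max: "s j \<le> s i" if "j \<in> S" for j using S that by simp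
  have iS: "i < n" "0 < s i" using i s[of i] by (auto simp: S_def)
  have "\<mu> * s i \<le> (\<Sum>j<n. m i j * s j)" using sub iS by simp
  also have "\<dots> = (\<Sum>j\<in>S - {i}. m i j * s j)"
    by (rule sum.mono_neutral_right) (use diag iS in \<open>auto simp: S_def\<close>)
  finally have *: "\<mu> * s i \<le> (\<Sum>j\<in>S - {i}. m i j * s j)" .
  have "card (S - {i}) \<le> 1" using small i S by (simp add: S_def[symmetric])
  moreover have "0 < \<mu> * s i" using \<open>0 < \<mu>\<close> iS by simp
  then have "S - {i} \<noteq> {}" using * by (metis not_less sum.empty)
  ultimately obtain j where j: "S - {i} = {j}"
    using S by (metis card_0_eq card_1_singletonE finite_Diff le_neq_implies_less less_one)
  then have jn: "j < n" "j \<noteq> i" "j \<in> S" by (auto simp: S_def)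
  have "\<mu> * s i \<le> m i j * s j" using * j by simp
  also have "\<dots> \<le> m i j * s i" using max[OF jn(3)] m[OF iS(1) jn(1)] by (rule mult_left_mono)
  finally have "\<mu> \<le> m i j" using iS by simp
  with iS jn show ?thesis by blast
qed

text \<open>Here the size \<open>5\<close> enters: of two disjoint subsets of five indices one has at most two elements.\<close>

lemma large_entry_of_disjoint_supports:
  fixes m :: "nat \<Rightarrow> nat \<Rightarrow> real" and s t :: "nat \<Rightarrow> real"
  assumes "n \<le> 5" "0 < \<mu>" and m: "\<And>i j. i < n \<Longrightarrow> j < n \<Longrightarrow> 0 \<le> m i j"
    and diag: "\<And>i. i < n \<Longrightarrow> m i i = 0"
    and s: "\<And>i. i < n \<Longrightarrow> 0 \<le> s i" "\<exists>i<n. s i \<noteq> 0"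
      "\<And>i. i < n \<Longrightarrow> s i \<noteq> 0 \<Longrightarrow> \<mu> * s i \<le> (\<Sum>j<n. m i j * s j)"
    and t: "\<And>i. i < n \<Longrightarrow> 0 \<le> t i" "\<exists>i<n. t i \<noteq> 0"
      "\<And>i. i < n \<Longrightarrow> t i \<noteq> 0 \<Longrightarrow> \<mu> * t i \<le> (\<Sum>j<n. m i j * t j)"
    and disj: "\<And>i. i < n \<Longrightarrow> s i = 0 \<or> t i = 0"
  shows "\<exists>i<n. \<exists>j<n. i \<noteq> j \<and> \<mu> \<le> m i j"
proof -
  have "card {i. i < n \<and> s i \<noteq> 0} + card {i. i < n \<and> t i \<noteq> 0}
      = card ({i. i < n \<and> s i \<noteq> 0} \<union> {i. i < n \<and> t i \<noteq> 0})"
    by (rule card_Un_disjoint[symmetric]) (use disj in auto)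
  also have "\<dots> \<le> card {..<n}" by (rule card_mono) auto
  finally consider "card {i. i < n \<and> s i \<noteq> 0} \<le> 2" | "card {i. i < n \<and> t i \<noteq> 0} \<le> 2"
    using \<open>n \<le> 5\<close> by fastforce
  then show ?thesis
  proof cases
    case 1
    from s(2) obtain i\<^sub>0 where "i\<^sub>0 < n" "s i\<^sub>0 \<noteq> 0" by auto
    from large_entry_of_small_support[of \<mu> n m s, OF \<open>0 < \<mu>\<close> m diag s(1) 1 this s(3)]
    show ?thesis by blast
  next
    case 2
    from t(2) obtain i\<^sub>0 where "i\<^sub>0 < n" "t i\<^sub>0 \<noteq> 0" by auto
    from large_entry_of_small_support[of \<mu> n m t, OF \<open>0 < \<mu>\<close> m diag t(1) 2 this t(3)]
    show ?thesis by blast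
  qed
qed

text \<open>Replacing a top eigenvector by its entrywise absolute value \<open>y\<close> does not decrease the quadratic form,
  so \<open>y\<close> is again a top eigenvector. If it is orthogonal to the second basis vector, this vector
  serves as \<open>z\<close>. Otherwise the top eigenvalue is multiple, and a combination \<open>z\<close> of the first two
  basis vectors is orthogonal to \<open>y\<close>.\<close>

lemma perron_and_second_eigenvector:
  assumes n: "2 \<le> n"
    and m: "\<And>i j. i < n \<Longrightarrow> j < n \<Longrightarrow> 0 \<le> m i j"
    and u: "eigenbasis n m c u" and ord: "\<And>k. k < n \<Longrightarrow> c k \<le> c 0"
  shows "\<exists>y z. (\<forall>i. 0 \<le> y i) \<and> (\<exists>i<n. y i \<noteq> 0) \<and> (\<exists>i<n. z i \<noteq> 0) \<and> (\<Sum>i<n. y i * z i) = 0 \<and>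
    (\<forall>i<n. (\<Sum>j<n. m i j * y j) = c 0 * y i) \<and> (\<forall>i<n. (\<Sum>j<n. m i j * z j) = c 1 * z i)"
proof -
  note orth = eigenbasis_orthonormal[OF u]
  note eig = eigenbasis_eigenvector[OF u]
  define y where "y i = \<bar>u 0 i\<bar>" for i
  define \<alpha> where "\<alpha> k = (\<Sum>j<n. u k j * y j)" for k
  have norm_y: "(\<Sum>i<n. (y i)\<^sup>2) = 1"
    using orth[of 0 0] n by (simp add: y_def power2_eq_square)
  have norm_\<alpha>: "(\<Sum>k<n. (\<alpha> k)\<^sup>2) = 1"
    using eigenbasis_parseval[OF u, of y] norm_y by (simp add: \<alpha>_def)
  have "c 0 = (\<Sum>i<n. u 0 i * (c 0 * u 0 i))"
    using orth[of 0 0] n by (simp add: mult.left_commute sum_distrib_left[symmetric])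
  also have "\<dots> = (\<Sum>i<n. u 0 i * (\<Sum>j<n. m i j * u 0 j))"
    using n by (intro sum.cong) (auto simp: eig)
  also have "\<dots> = (\<Sum>i<n. \<Sum>j<n. u 0 i * m i j * u 0 j)"
    by (simp add: sum_distrib_left mult_ac)
  also have "\<dots> \<le> (\<Sum>i<n. \<Sum>j<n. y i * m i j * y j)"
  proof (intro sum_mono)
    fix i j assume "i \<in> {..<n}" "j \<in> {..<n}"
    then have "y i * m i j * y j = \<bar>u 0 i * m i j * u 0 j\<bar>" using m by (simp add: y_def abs_mult)
    then show "u 0 i * m i j * u 0 j \<le> y i * m i j * y j" by simp
  qed
  also have "\<dots> = (\<Sum>k<n. c k * (\<alpha> k)\<^sup>2)"
    unfolding \<alpha>_def by (rule eigenbasis_quadratic_form[OF u])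
  finally have "(\<Sum>k<n. (c 0 - c k) * (\<alpha> k)\<^sup>2) \<le> 0"
    using norm_\<alpha> by (simp add: algebra_simps sum_subtractf sum_distrib_left[symmetric])
  moreover have nonneg: "0 \<le> (c 0 - c k) * (\<alpha> k)\<^sup>2" if "k < n" for k using ord[OF that] by simp
  ultimately have "(\<Sum>k<n. (c 0 - c k) * (\<alpha> k)\<^sup>2) = 0"
    by (intro antisym sum_nonneg) auto
  then have "(c 0 - c k) * (\<alpha> k)\<^sup>2 = 0" if "k < n" for k
    using nonneg that by (subst (asm) sum_nonneg_eq_0_iff) auto
  then have top: "c k = c 0 \<or> \<alpha> k = 0" if "k < n" for k
    using that by fastforce
  have y_eig: "(\<Sum>j<n. m i j * y j) = c 0 * y i" if "i < n" for i
  proof -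
    have "(\<Sum>j<n. m i j * y j) = (\<Sum>k<n. c 0 * (\<alpha> k * u k i))"
      unfolding eigenbasis_apply[OF u that] \<alpha>_def[symmetric] using top by (intro sum.cong) auto
    then show ?thesis
      using eigenbasis_expansion[OF u that, of y] by (simp add: sum_distrib_left[symmetric] \<alpha>_def)
  qed
  have y0: "\<And>i. 0 \<le> y i" by (simp add: y_def)
  have y_nz: "\<exists>i<n. y i \<noteq> 0"
  proof (rule ccontr)
    assume "\<not> ?thesis"
    then have "(\<Sum>i<n. (y i)\<^sup>2) = 0" by simp
    with norm_y show False by simp
  qed
  have nz: "\<exists>i<n. x i \<noteq> 0" if "(\<Sum>i<n. u k i * x i) \<noteq> 0" for k x
    using that by (metis (no_types, lifting) lessThan_iff mult_zero_right sum.neutral)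
  show ?thesis
  proof (cases "\<alpha> 1 = 0")
    case True
    show ?thesis
    proof (rule exI[of _ y], rule exI[of _ "u 1"], intro conjI)
      show "\<exists>i<n. u 1 i \<noteq> 0" using orth[of 1 1] n by (intro nz[of 1]) auto
      show "(\<Sum>i<n. y i * u 1 i) = 0" using True by (simp add: \<alpha>_def mult.commute)
    qed (use y0 y_nz y_eig eig n in auto)
  next
    case False
    then have c1: "c 1 = c 0" using top[of 1] n by simp
    define z where "z i = \<alpha> 1 * u 0 i - \<alpha> 0 * u 1 i" for i
    have "(\<Sum>i<n. u 0 i * z i) = \<alpha> 1 * (\<Sum>i<n. u 0 i * u 0 i) - \<alpha> 0 * (\<Sum>i<n. u 0 i * u 1 i)"
      by (simp add: z_def algebra_simps sum_subtractf sum_distrib_left)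
    then have z_nz: "\<exists>i<n. z i \<noteq> 0"
      using orth[of 0 0] orth[of 0 1] n False by (intro nz[of 0]) auto
    have "(\<Sum>i<n. y i * z i) = \<alpha> 1 * (\<Sum>i<n. u 0 i * y i) - \<alpha> 0 * (\<Sum>i<n. u 1 i * y i)"
      by (simp add: z_def algebra_simps sum_subtractf sum_distrib_left)
    then have yz: "(\<Sum>i<n. y i * z i) = 0" by (simp add: \<alpha>_def)
    have "(\<Sum>j<n. m i j * z j) = c 1 * z i" if "i < n" for i
    proof -
      have "(\<Sum>j<n. m i j * z j) = \<alpha> 1 * (\<Sum>j<n. m i j * u 0 j) - \<alpha> 0 * (\<Sum>j<n. m i j * u 1 j)"
        by (simp add: z_def algebra_simps sum_subtractf sum_distrib_left)
      also have "\<dots> = \<alpha> 1 * (c 0 * u 0 i) - \<alpha> 0 * (c 1 * u 1 i)" using eig[OF that] n by simp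
      also have "\<dots> = c 1 * z i" using c1 by (simp add: z_def algebra_simps)
      finally show ?thesis .
    qed
    with y0 y_nz z_nz yz y_eig show ?thesis by blast
  qed
qed

text \<open>Let \<open>\<mu>\<close> be the second eigenvalue with eigenvector \<open>z\<close>, orthogonal to a nonnegative top eigenvector
  \<open>y\<close>. If \<open>z\<close> has entries of both signs, its positive and negative parts are nonnegative vectors with
  disjoint supports that the matrix stretches by at least \<open>\<mu>\<close> on their supports; if not, \<open>z\<close> up to
  sign and \<open>y\<close> are such vectors. So some entry \<open>m i j\<close> is at least \<open>\<mu>\<close>, and the quadratic form at
  \<open>e\<^sub>i - e\<^sub>j\<close> shows that the last eigenvalue is at most \<open>- m i j\<close>.\<close>

theorem second_plus_last_eigenvalue_nonpos:
  fixes M :: "real mat"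
  assumes M: "M \<in> carrier_mat n n" and n: "2 \<le> n" "n \<le> 5" and sym: "M\<^sup>T = M"
    and nonneg: "nonneg_entries M" and diag: "\<And>i. i < n \<Longrightarrow> M $$ (i, i) = 0"
    and spec: "has_spectrum M \<sigma>" and len: "length \<sigma> = n" and sorted: "sorted_wrt (\<ge>) \<sigma>"
  shows "\<sigma> ! 1 + \<sigma> ! (n - 1) \<le> 0"
proof (rule ccontr)
  assume contr: "\<not> ?thesis"
  have ord: "\<sigma> ! l \<le> \<sigma> ! k" if "k \<le> l" "l < n" for k l
    using sorted_wrt_nth_less[OF sorted, of k l] that len by (cases "k = l") auto
  define \<mu> where "\<mu> = \<sigma> ! 1"
  have "1 \<le> n - 1" using n by linarith
  then have \<mu>: "0 < \<mu>" "\<mu> \<le> \<sigma> ! 0"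
    using contr ord[of 1 "n - 1"] ord[of 0 1] n by (auto simp: \<mu>_def)
  define m where "m i j = M $$ (i, j)" for i j
  have m: "0 \<le> m i j" if "i < n" "j < n" for i j
    using nonneg M that by (auto simp: nonneg_entries_def m_def)
  have m0: "m i i = 0" if "i < n" for i using diag that by (simp add: m_def)
  have msym: "m i j = m j i" if "i < n" "j < n" for i j
    using arg_cong[OF sym, of "\<lambda>A. A $$ (i, j)"] that M by (simp add: m_def)
  obtain u where u: "eigenbasis n m (\<lambda>k. \<sigma> ! k) u"
    using eigenbasis_exists[OF M sym spec] unfolding m_def by blast
  obtain y z where y: "\<And>i. 0 \<le> y i" "\<exists>i<n. y i \<noteq> 0" and z: "\<exists>i<n. z i \<noteq> 0"
    and yz: "(\<Sum>i<n. y i * z i) = 0"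
    and y_eig: "\<And>i. i < n \<Longrightarrow> (\<Sum>j<n. m i j * y j) = \<sigma> ! 0 * y i"
    and z_eig: "\<And>i. i < n \<Longrightarrow> (\<Sum>j<n. m i j * z j) = \<mu> * z i"
    using perron_and_second_eigenvector[OF n(1) m u ord[OF le0]]
    unfolding \<mu>_def by auto
  have part: "\<mu> * max 0 (a * z i) \<le> (\<Sum>j<n. m i j * max 0 (a * z j))"
    if "i < n" "max 0 (a * z i) \<noteq> 0" for a i
  proof -
    have "\<mu> * max 0 (a * z i) = a * (\<mu> * z i)" using that(2) by (auto simp: max_def split: if_splits)
    also have "\<dots> = (\<Sum>j<n. m i j * (a * z j))"
      by (simp add: z_eig[OF that(1), symmetric] sum_distrib_left mult_ac)
    also have "\<dots> \<le> (\<Sum>j<n. m i j * max 0 (a * z j))"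
      using m that(1) by (intro sum_mono mult_left_mono) auto
    finally show ?thesis .
  qed
  have one_sign: "\<exists>i<n. \<exists>j<n. i \<noteq> j \<and> \<mu> \<le> m i j"
    if a: "a \<noteq> 0" and az: "\<And>i. i < n \<Longrightarrow> 0 \<le> a * z i" for a
  proof (rule large_entry_of_disjoint_supports[of n \<mu> m "\<lambda>i. max 0 (a * z i)" y])
    show "\<exists>i<n. max 0 (a * z i) \<noteq> 0" using z a az by (metis max_def mult_eq_0_iff)
    show "\<mu> * y i \<le> (\<Sum>j<n. m i j * y j)" if "i < n" for i
      unfolding y_eig[OF that] using \<mu>(2) y(1) by (rule mult_right_mono)
    have "(\<Sum>i<n. y i * (a * z i)) = 0"
      using yz by (simp add: mult.left_commute sum_distrib_left[symmetric])
    then show "max 0 (a * z i) = 0 \<or> y i = 0" if "i < n" for i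
      using that az y(1) by (subst (asm) sum_nonneg_eq_0_iff) auto
  qed (use n \<mu> m m0 y part in auto)
  have "\<exists>i<n. \<exists>j<n. i \<noteq> j \<and> \<mu> \<le> m i j"
  proof (cases "\<exists>i<n. 0 < z i")
    case True
    show ?thesis
    proof (cases "\<exists>i<n. z i < 0")
      case neg: True
      show ?thesis
      proof (rule large_entry_of_disjoint_supports
          [of n \<mu> m "\<lambda>i. max 0 (1 * z i)" "\<lambda>i. max 0 (- 1 * z i)"])
      qed (use n \<mu> m m0 part[of _ 1] part[of _ "-1"] True neg in \<open>auto simp: max_def\<close>)
    next
      case False
      then show ?thesis by (intro one_sign[of 1]) force+
    qed
  next
    case False
    then show ?thesis by (intro one_sign[of "-1"]) force+
  qed
  then obtain i j where ij: "i < n" "j < n" "i \<noteq> j" "\<mu> \<le> m i j" by blast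
  define x :: "nat \<Rightarrow> real" where "x k = (if k = i then 1 else if k = j then -1 else 0)" for k
  have x_sum: "(\<Sum>k<n. g k * x k) = g i - g j" for g
  proof -
    have "(\<Sum>k<n. g k * x k) = (\<Sum>k<n. (if k = i then g i else 0) - (if k = j then g j else 0))"
      by (rule sum.cong) (use ij in \<open>auto simp: x_def\<close>)
    then show ?thesis using ij by (simp add: sum_subtractf)
  qed
  have "(\<Sum>k<n. (x k)\<^sup>2) = 2"
    using x_sum[of x] ij by (simp add: power2_eq_square x_def)
  then have "2 * \<sigma> ! (n - 1) = (\<Sum>k<n. \<sigma> ! (n - 1) * (\<Sum>i<n. u k i * x i)\<^sup>2)"
    using eigenbasis_parseval[OF u, of x] by (simp add: sum_distrib_left[symmetric])
  also have "\<dots> \<le> (\<Sum>k<n. \<sigma> ! k * (\<Sum>i<n. u k i * x i)\<^sup>2)"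
    using ord by (intro sum_mono mult_right_mono) auto
  also have "\<dots> = (\<Sum>k<n. \<Sum>l<n. x k * m k l * x l)"
    by (rule eigenbasis_quadratic_form[OF u, symmetric])
  also have "\<dots> = (\<Sum>k<n. (m k i - m k j) * x k)"
    using x_sum[of "\<lambda>l. x k * m k l" for k] by (intro sum.cong refl) (simp add: algebra_simps)
  also have "\<dots> = - 2 * m i j"
    using ij m0 msym[of i j] by (simp add: x_sum)
  finally have "\<sigma> ! (n - 1) \<le> - m i j" by simp
  with ij(4) contr show False by (simp add: \<mu>_def)
qed

section \<open>Small determinants\<close>

text \<open>Expansion along the first column, stated for matrices given by a function of the indices; unrolled
  in the following lemmas, it lets the simplifier evaluate determinants of size \<open>5\<close>.\<close>

lemma det_mat_Suc:
  fixes F :: "nat \<times> nat \<Rightarrow> 'a :: comm_ring_1"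
  shows "det (mat (Suc n) (Suc n) F) = (\<Sum>i<Suc n. (- 1) ^ i * F (i, 0) *
    det (mat n n (\<lambda>(r, c). F (if r < i then r else Suc r, Suc c))))"
proof -
  have "mat_delete (mat (Suc n) (Suc n) F) i 0
      = mat n n (\<lambda>(r, c). F (if r < i then r else Suc r, Suc c))" for i
    by (rule eq_matI) (auto simp: mat_delete_def)
  then show ?thesis
    by (subst laplace_expansion_column[of _ "Suc n" 0]) (auto simp: cofactor_def mult_ac intro!: sum.cong)
qed

lemma det_mat_1: "det (mat 1 1 F) = F (0, 0)" for F :: "nat \<times> nat \<Rightarrow> 'a :: comm_ring_1"
  using det_mat_Suc[of 0 F] by simp

lemma det_mat_2:
  "det (mat 2 2 F) = F (0, 0) * F (1, 1) - F (1, 0) * F (0, 1)" for F :: "nat \<times> nat \<Rightarrow> 'a :: comm_ring_1"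
  using det_mat_Suc[of 1 F] by (simp add: det_mat_1[simplified] numeral_2_eq_2)

lemma det_mat_3:
  "det (mat 3 3 F) = F (0, 0) * det (mat 2 2 (\<lambda>(r, c). F (Suc r, Suc c)))
    - F (1, 0) * det (mat 2 2 (\<lambda>(r, c). F (if r < 1 then r else Suc r, Suc c)))
    + F (2, 0) * det (mat 2 2 (\<lambda>(r, c). F (if r < 2 then r else Suc r, Suc c)))"
    for F :: "nat \<times> nat \<Rightarrow> 'a :: comm_ring_1"
proof -
  have 3: "{..<3} = {0, 1, 2::nat}" by auto
  show ?thesis using det_mat_Suc[of 2 F] by (simp add: 3)
qed

lemma det_mat_4:
  "det (mat 4 4 F) = F (0, 0) * det (mat 3 3 (\<lambda>(r, c). F (Suc r, Suc c)))
    - F (1, 0) * det (mat 3 3 (\<lambda>(r, c). F (if r < 1 then r else Suc r, Suc c)))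
    + F (2, 0) * det (mat 3 3 (\<lambda>(r, c). F (if r < 2 then r else Suc r, Suc c)))
    - F (3, 0) * det (mat 3 3 (\<lambda>(r, c). F (if r < 3 then r else Suc r, Suc c)))"
    for F :: "nat \<times> nat \<Rightarrow> 'a :: comm_ring_1"
proof -
  have 4: "{..<4} = {0, 1, 2, 3::nat}" by auto
  show ?thesis using det_mat_Suc[of 3 F] by (simp add: 4)
qed

lemma det_mat_5:
  "det (mat 5 5 F) = F (0, 0) * det (mat 4 4 (\<lambda>(r, c). F (Suc r, Suc c)))
    - F (1, 0) * det (mat 4 4 (\<lambda>(r, c). F (if r < 1 then r else Suc r, Suc c)))
    + F (2, 0) * det (mat 4 4 (\<lambda>(r, c). F (if r < 2 then r else Suc r, Suc c)))
    - F (3, 0) * det (mat 4 4 (\<lambda>(r, c). F (if r < 3 then r else Suc r, Suc c)))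
    + F (4, 0) * det (mat 4 4 (\<lambda>(r, c). F (if r < 4 then r else Suc r, Suc c)))"
    for F :: "nat \<times> nat \<Rightarrow> 'a :: comm_ring_1"
proof -
  have 5: "{..<5} = {0, 1, 2, 3, 4::nat}" by auto
  show ?thesis using det_mat_Suc[of 4 F] by (simp add: 5)
qed

section \<open>Matrices with a reflection symmetry\<close>

text \<open>The general form of a symmetric matrix with zero diagonal that commutes with the permutation fixing
  \<open>0\<close> and swapping \<open>1\<close> with \<open>3\<close> and \<open>2\<close> with \<open>4\<close>.\<close>

definition reflection_mat :: "real \<Rightarrow> real \<Rightarrow> real \<Rightarrow> real \<Rightarrow> real \<Rightarrow> real \<Rightarrow> real mat" where
  "reflection_mat a b e f g h = mat 5 5 (\<lambda>(i, j).
     [[0, a, b, a, b],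
      [a, 0, f, e, g],
      [b, f, 0, g, h],
      [a, e, g, 0, f],
      [b, g, h, f, 0]] ! i ! j)"

lemma less_5_cases: "i < (5::nat) \<Longrightarrow> i = 0 \<or> i = 1 \<or> i = 2 \<or> i = 3 \<or> i = 4"
  by auto

text \<open>The factors are the characteristic polynomials of the blocks on the symmetric and on the
  antisymmetric vectors, which in orthonormal bases are
  \<open>[[0, sqrt 2 a, sqrt 2 b], [sqrt 2 a, e, f + g], [sqrt 2 b, f + g, h]]\<close> and
  \<open>[[- e, f - g], [f - g, - h]]\<close>.\<close>

lemma poly_char_poly_reflection_mat:
  "poly (char_poly (reflection_mat a b e f g h)) t =
    (t ^ 3 - (e + h) * t\<^sup>2 + (e * h - 2 * a\<^sup>2 - 2 * b\<^sup>2 - (f + g)\<^sup>2) * t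
       - (4 * a * b * (f + g) - 2 * b\<^sup>2 * e - 2 * a\<^sup>2 * h)) *
    (t\<^sup>2 + (e + h) * t + (e * h - (f - g)\<^sup>2))"
proof -
  define L where "L = [[0, a, b, a, b],
      [a, 0, f, e, g],
      [b, f, 0, g, h],
      [a, e, g, 0, f],
      [b, g, h, f, 0]]"
  define F where "F = (\<lambda>(i, j). (if i = j then t else 0) - L ! i ! j)"
  have "map_mat (\<lambda>p. poly p t) (char_poly_matrix (reflection_mat a b e f g h))
      = mat 5 5 F"
    by (rule eq_matI) (auto simp: char_poly_matrix_def reflection_mat_def L_def one_pCons F_def)
  then have "poly (char_poly (reflection_mat a b e f g h)) t = det (mat 5 5 F)"
    unfolding char_poly_def
    using comm_ring_hom.hom_det[OF poly_hom.comm_ring_hom_axioms, of t] by metis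
  also have "\<dots> = (t ^ 3 - (e + h) * t\<^sup>2 + (e * h - 2 * a\<^sup>2 - 2 * b\<^sup>2 - (f + g)\<^sup>2) * t
       - (4 * a * b * (f + g) - 2 * b\<^sup>2 * e - 2 * a\<^sup>2 * h)) *
    (t\<^sup>2 + (e + h) * t + (e * h - (f - g)\<^sup>2))"
    by (simp add: det_mat_5 det_mat_4 det_mat_3 det_mat_2 F_def L_def del: One_nat_def)
      (simp add: power2_eq_square power3_eq_cube algebra_simps)
  finally show ?thesis .
qed

text \<open>By Vieta's formulas it suffices to match the elementary symmetric functions of the eigenvalues with
  the coefficients of the two factors.\<close>

lemma reflection_mat_realizes:
  assumes nonneg: "0 \<le> a" "0 \<le> b" "0 \<le> e" "0 \<le> f" "0 \<le> g" "0 \<le> h"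
    and cubic: "p + q + r = e + h" "p * q + p * r + q * r = e * h - 2 * a\<^sup>2 - 2 * b\<^sup>2 - (f + g)\<^sup>2"
      "p * q * r = 4 * a * b * (f + g) - 2 * b\<^sup>2 * e - 2 * a\<^sup>2 * h"
    and quadratic: "s + w = - (e + h)" "s * w = e * h - (f - g)\<^sup>2"
    and \<sigma>: "mset \<sigma> = {#p, q, r, s, w#}"
  shows "\<exists>M \<in> carrier_mat 5 5. M\<^sup>T = M \<and> nonneg_entries M \<and> mat_trace M = 0 \<and> has_spectrum M \<sigma>"
proof (intro bexI conjI)
  let ?M = "reflection_mat a b e f g h"
  show "?M \<in> carrier_mat 5 5" by (simp add: reflection_mat_def)
  show "?M\<^sup>T = ?M"
    by (rule eq_matI) (auto simp: reflection_mat_def dest!: less_5_cases)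
  show "nonneg_entries ?M"
    using nonneg by (auto simp: nonneg_entries_def reflection_mat_def dest!: less_5_cases)
  show "mat_trace ?M = 0"
    by (auto simp: mat_trace_def reflection_mat_def intro!: sum.neutral dest!: less_5_cases)
  have "(\<Prod>l\<leftarrow>\<sigma>. [:- l, 1:]) = prod_mset (image_mset (\<lambda>l. [:- l, 1:]) (mset \<sigma>))"
    by (simp flip: prod_mset_prod_list)
  also have "\<dots> = [:- p, 1:] * [:- q, 1:] * [:- r, 1:] * ([:- s, 1:] * [:- w, 1:])"
    unfolding \<sigma> by (simp add: mult.assoc del: mult_pCons_left mult_pCons_right)
  also have "\<dots> = char_poly ?M"
  proof (rule poly_ext)
    fix t
    have "poly ([:- p, 1:] * [:- q, 1:] * [:- r, 1:]) t
        = t ^ 3 - (p + q + r) * t\<^sup>2 + (p * q + p * r + q * r) * t - p * q * r"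
      by (simp add: power2_eq_square power3_eq_cube algebra_simps)
    moreover have "poly ([:- s, 1:] * [:- w, 1:]) t = t\<^sup>2 + - (s + w) * t + s * w"
      by (simp add: power2_eq_square algebra_simps)
    ultimately show "poly ([:- p, 1:] * [:- q, 1:] * [:- r, 1:] * ([:- s, 1:] * [:- w, 1:])) t
        = poly (char_poly ?M) t"
      by (simp only: poly_char_poly_reflection_mat poly_mult[of "_ * _ * _"] cubic quadratic minus_minus)
  qed
  finally show "has_spectrum ?M \<sigma>" by (simp add: has_spectrum_def)
qed

text \<open>This is the gluing of two smaller matrices by Fiedler's method: a matrix of size \<open>3\<close> with eigenvalues
  \<open>\<alpha> = - y - z, y, z\<close> and one of size \<open>2\<close> with eigenvalues \<open>1 + d, - d - 1\<close>. Joining them through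
  their unit Perron vectors with total weight \<open>sqrt K\<close> replaces the top eigenvalues \<open>\<alpha>\<close> and \<open>1 + d\<close>,
  whose sum is \<open>1 + x\<close>, by \<open>1\<close> and \<open>x\<close>, provided that \<open>K\<close> is the difference
  \<open>\<alpha> (1 + d) - x\<close> of the products. Both matrices have a reflection symmetry, and the Perron vectors
  share it, so the result has the form of a \<open>reflection_mat\<close>.\<close>

lemma realizable_third_nonpos:
  fixes d x y z :: real
  assumes d: "-1 \<le> d" "d \<le> 0" and sum: "x + y + z = d" and ord: "z \<le> y" and y: "y \<le> 0"
    and x: "x \<le> d + 1"
  shows "\<exists>M \<in> carrier_mat 5 5. M\<^sup>T = M \<and> nonneg_entries M \<and> mat_trace M = 0 \<and>
    has_spectrum M [1, x, y, z, - d - 1]"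
proof -
  define \<alpha> where "\<alpha> = - (y + z)"
  have \<alpha>: "0 \<le> \<alpha>" and z: "z \<le> 0" using ord y by (auto simp: \<alpha>_def)
  have x_eq: "x = d + \<alpha>" using sum by (simp add: \<alpha>_def)
  define K where "K = \<alpha> * (1 + d) - x"
  have "K = (- d) * (d + 1 - x)" by (simp add: K_def x_eq algebra_simps)
  then have K: "0 \<le> K" using d x by (metis diff_ge_0_iff_ge mult_nonneg_nonneg neg_0_le_iff_le)
  \<comment> \<open>\<open>sqrt U, sqrt U, sqrt V\<close> are the entries of the unit Perron vector of the matrix of size \<open>3\<close>.\<close>
  obtain U V where UV: "0 \<le> U" "0 \<le> V" "2 * U + V = 1" "\<alpha> * V = - 2 * z * U"
  proof (cases "\<alpha> - z = 0")
    case True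
    then have "\<alpha> = 0" "z = 0" using \<alpha> z by auto
    then show ?thesis using that[of "1 / 2" 0] by simp
  next
    case False
    define D where "D = \<alpha> - z"
    have D: "0 < D" using False \<alpha> z by (simp add: D_def)
    have "2 * (\<alpha> / (2 * D)) + - z / D = (\<alpha> - z) / D" by (simp add: diff_divide_distrib)
    also have "\<dots> = 1" using D by (simp add: D_def)
    finally show ?thesis using D \<alpha> z
      by (intro that[of "\<alpha> / (2 * D)" "- z / D"]) (auto simp: divide_nonpos_pos)
  qed
  define A where "A = sqrt (- \<alpha> * z / 2)"
  define B where "B = sqrt (K * V / 2)"
  define F where "F = sqrt (K * U / 2)"
  have "0 \<le> - \<alpha> * z / 2" "0 \<le> K * V / 2" "0 \<le> K * U / 2"
    using \<alpha> z K UV by (auto simp: mult_nonneg_nonpos)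
  then have sq: "A\<^sup>2 = - \<alpha> * z / 2" "B\<^sup>2 = K * V / 2" "F\<^sup>2 = K * U / 2"
    and pos: "0 \<le> A" "0 \<le> B" "0 \<le> F"
    unfolding A_def B_def F_def by (simp_all only: real_sqrt_pow2 real_sqrt_ge_0_iff)
  have "A * B * F = - z * K * U / 2"
  proof (rule power2_eq_imp_eq)
    have "(A * B * F)\<^sup>2 = A\<^sup>2 * B\<^sup>2 * F\<^sup>2" by (simp only: power_mult_distrib)
    also have "\<dots> = (\<alpha> * V) * (- z) * K\<^sup>2 * U / 8"
      unfolding sq by (simp add: power2_eq_square)
    also have "\<dots> = (- z * K * U / 2)\<^sup>2"
      unfolding UV(4) by (simp add: power2_eq_square)
    finally show "(A * B * F)\<^sup>2 = (- z * K * U / 2)\<^sup>2" .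
    show "0 \<le> - z * K * U / 2" using z K UV by (simp add: mult_nonpos_nonneg)
  qed (use pos in auto)
  then have ABF: "4 * A * B * (F + F) = - 4 * z * K * U" by (simp add: algebra_simps)
  have b: "K * V = K - 2 * (K * U)" using UV(3) by (metis add_diff_cancel_left' mult.left_commute
        mult.right_neutral right_diff_distrib)
  have "K * (y + z) * V = 2 * z * K * U"
    using arg_cong[OF UV(4), of "\<lambda>v. K * v"] by (simp add: \<alpha>_def algebra_simps)
  then have yb: "K * V * y = 2 * z * K * U - K * V * z" by (simp add: algebra_simps)
  show ?thesis
  proof (rule reflection_mat_realizes[of A B "- y" F F "1 + d" 1 x z y "- d - 1"])
    show "1 + x + z = - y + (1 + d)" using sum by simp
    show "1 * x + 1 * z + x * z = - y * (1 + d) - 2 * A\<^sup>2 - 2 * B\<^sup>2 - (F + F)\<^sup>2"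
    proof -
      have "(F + F)\<^sup>2 = 2 * (K * U)" using sq(3) by (simp add: power2_eq_square algebra_simps)
      moreover have "2 * B\<^sup>2 = K - 2 * (K * U)" "2 * A\<^sup>2 = - \<alpha> * z" using sq b by simp_all
      ultimately have "- y * (1 + d) - 2 * A\<^sup>2 - 2 * B\<^sup>2 - (F + F)\<^sup>2 = - y * (1 + d) + \<alpha> * z - K"
        by simp
      also have "\<dots> = 1 * x + 1 * z + x * z"
        unfolding K_def \<alpha>_def sum[symmetric] by (simp add: algebra_simps)
      finally show ?thesis ..
    qed
    show "1 * x * z = 4 * A * B * (F + F) - 2 * B\<^sup>2 * (- y) - 2 * A\<^sup>2 * (1 + d)"
    proof -
      have "4 * A * B * (F + F) - 2 * B\<^sup>2 * (- y) - 2 * A\<^sup>2 * (1 + d)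
          = - 2 * z * K * U - K * V * z + \<alpha> * z * (1 + d)"
        unfolding ABF sq using yb by simp
      also have "\<dots> = - z * K + \<alpha> * z * (1 + d)" unfolding b by (simp add: algebra_simps)
      also have "\<dots> = 1 * x * z" by (simp add: K_def algebra_simps)
      finally show ?thesis ..
    qed
    show "mset [1, x, y, z, - d - 1] = {#1, x, z, y, - d - 1#}" by simp
  qed (use d y pos in \<open>auto simp: algebra_simps\<close>)
qed

text \<open>The choice \<open>a = h = 0\<close> leaves a weighted five-cycle with the additional weight \<open>g\<close>. The
  antisymmetric block then forces \<open>f - g = sqrt (x (1 + d))\<close>, the symmetric one determines \<open>f + g\<close>,
  and \<open>g\<close> is nonnegative precisely if the cubic is nonpositive. On the curve where the cubic
  vanishes, \<open>g = 0\<close> and the graph is the five-cycle itself, which contains no triangle.\<close>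

lemma realizable_third_pos:
  fixes d x y z :: real
  assumes d: "-1 \<le> d" "d \<le> 0" and sum: "x + y + z = d" and ord: "y \<le> x" and y: "0 < y"
    and x: "x \<le> d + 1" and cubic: "cubic d x y \<le> 0"
  shows "\<exists>M \<in> carrier_mat 5 5. M\<^sup>T = M \<and> nonneg_entries M \<and> mat_trace M = 0 \<and>
    has_spectrum M [1, x, y, z, - d - 1]"
proof -
  define c where "c = 1 + d - x"
  have "x \<noteq> d + 1"
  proof
    assume "x = d + 1"
    with cubic have "y * (y + 1) \<le> 0" by (simp add: cubic_def algebra_simps)
    with y show False by (simp add: mult_le_0_iff)
  qed
  then have c: "0 < c" using x by (simp add: c_def)
  have z: "z \<le> 0" and x0: "0 < x" using sum ord y d by auto
  define P where "P = x * (1 + d)"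
  define Q where "Q = y * z / c - (y + z + y * z)"
  have "c * (Q - P) = - cubic d x y"
  proof -
    have "c * Q = y * z - c * (y + z + y * z)" using c by (simp add: Q_def field_simps)
    then have "c * (Q - P) = y * z - c * (y + z + y * z) - c * (x * (1 + d))"
      by (simp add: right_diff_distrib P_def)
    also have "z = d - x - y" using sum by simp
    finally show ?thesis by (simp add: c_def cubic_def algebra_simps)
  qed
  with cubic have "0 \<le> c * (Q - P)" by simp
  then have PQ: "P \<le> Q" using c by (simp add: zero_le_mult_iff)
  have P: "0 \<le> P" using x0 d by (simp add: P_def)
  define B where "B = sqrt (- y * z / (2 * c))"
  have B: "0 \<le> B" "B\<^sup>2 = - y * z / (2 * c)"
    using y z c by (auto simp: B_def divide_nonneg_pos mult_nonneg_nonpos divide_nonpos_pos)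
  define p q where "p = sqrt P" and "q = sqrt Q"
  have pq: "0 \<le> p" "p \<le> q" "p\<^sup>2 = P" "q\<^sup>2 = Q" using P PQ by (auto simp: p_def q_def)
  show ?thesis
  proof (rule reflection_mat_realizes[of 0 B c "(q + p) / 2" "(q - p) / 2" 0 1 y z x "- d - 1"])
    have q: "(q + p) / 2 + (q - p) / 2 = q" and p: "(q + p) / 2 - (q - p) / 2 = p"
      by (simp_all add: field_simps)
    show "1 * y + 1 * z + y * z = c * 0 - 2 * 0\<^sup>2 - 2 * B\<^sup>2 - ((q + p) / 2 + (q - p) / 2)\<^sup>2"
      unfolding q pq B using c by (simp add: Q_def field_simps)
    show "1 * y * z = 4 * 0 * B * ((q + p) / 2 + (q - p) / 2) - 2 * B\<^sup>2 * c - 2 * 0\<^sup>2 * 0"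
      unfolding B using c by (simp add: field_simps)
    show "x * (- d - 1) = c * 0 - ((q + p) / 2 - (q - p) / 2)\<^sup>2"
      unfolding p pq by (simp add: P_def algebra_simps)
    show "mset [1, x, y, z, - d - 1] = {#1, y, z, x, - d - 1#}" by simp
  qed (use c B pq sum in \<open>auto simp: c_def\<close>)
qed

section \<open>Characterization of the realizable spectra\<close>

text \<open>Both triples \<open>x, y, z\<close> and \<open>1, - d - 1, d\<close> are governed by the identity
  \<open>p\<^sup>3 + q\<^sup>3 + r\<^sup>3 = (p + q + r)\<^sup>3 - 3 (p + q) (q + r) (r + p)\<close>, used with the sum \<open>d\<close> in the first
  case and \<open>0\<close> (with \<open>1 - (1 + d) + d = 0\<close>) in the second.\<close>

lemma sum_of_cubes_eq_cubic:
  fixes d x y z :: real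
  assumes "x + y + z = d"
  shows "1 + x ^ 3 + y ^ 3 + z ^ 3 + (- d - 1) ^ 3 = - 3 * cubic d x y"
proof -
  have z: "z = d - x - y" using assms by simp
  show ?thesis unfolding z by (simp add: cubic_def power3_eq_cube algebra_simps)
qed

theorem normalized_realizable_iff_spectral_region:
  fixes d x y :: real
  assumes d: "-1 \<le> d" "d \<le> 0"
  shows "normalized_realizable [1, x, y, d - x - y, - d - 1] \<longleftrightarrow> (x, y) \<in> spectral_region d"
proof
  let ?\<sigma> = "[1, x, y, d - x - y, - d - 1]"
  assume "normalized_realizable ?\<sigma>"
  then obtain M where ord: "normalized ?\<sigma>" and M: "M \<in> carrier_mat 5 5" and sym: "M\<^sup>T = M"
    and nonneg: "nonneg_entries M" and tr: "mat_trace M = 0" and spec: "has_spectrum M ?\<sigma>"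
    by (auto simp: normalized_realizable_def)
  have diag: "M $$ (i, i) = 0" if "i < 5" for i
  proof -
    have "\<forall>i\<in>{..<5}. 0 \<le> M $$ (i, i)" using M nonneg by (auto simp: nonneg_entries_def)
    then have "\<forall>i\<in>{..<5}. M $$ (i, i) = 0"
      using tr M by (subst sum_nonneg_eq_0_iff[symmetric]) (auto simp: mat_trace_def)
    then show ?thesis using that by simp
  qed
  have sorted: "sorted_wrt (\<ge>) ?\<sigma>" using ord by (simp add: normalized_def)
  have "x + (- d - 1) \<le> 0"
    using second_plus_last_eigenvalue_nonpos[OF M _ _ sym nonneg diag spec _ sorted] by simp
  moreover have cubes: "1 + x ^ 3 + y ^ 3 + (d - x - y) ^ 3 + (- d - 1) ^ 3 = - 3 * cubic d x y"
    by (rule sum_of_cubes_eq_cubic) simp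
  have "0 \<le> 1 + x ^ 3 + y ^ 3 + (d - x - y) ^ 3 + (- d - 1) ^ 3"
    using sum_cubes_eigenvalues_nonneg[OF M sym nonneg spec] by (simp add: eval_nat_numeral)
  then have "cubic d x y \<le> 0" unfolding cubes by simp
  ultimately show "(x, y) \<in> spectral_region d" using sorted by (simp add: spectral_region_def)
next
  assume "(x, y) \<in> spectral_region d"
  then have order: "y \<le> x" "d \<le> x + 2 * y" "x + y \<le> 2 * d + 1" "x \<le> d + 1"
    and cubic: "cubic d x y \<le> 0" by (simp_all add: spectral_region_def)
  have "x \<le> 1" "- d - 1 \<ge> -1" using order d by linarith+
  then have "normalized [1, x, y, d - x - y, - d - 1]"
    using order by (simp add: normalized_def)
  moreover have "\<exists>M \<in> carrier_mat 5 5. M\<^sup>T = M \<and> nonneg_entries M \<and> mat_trace M = 0 \<and>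
    has_spectrum M [1, x, y, d - x - y, - d - 1]"
  proof (cases "y \<le> 0")
    case True
    then show ?thesis using d order by (intro realizable_third_nonpos) linarith+
  next
    case False
    then show ?thesis using d order cubic by (intro realizable_third_pos) linarith+
  qed
  ultimately show "normalized_realizable [1, x, y, d - x - y, - d - 1]"
    unfolding normalized_realizable_def by blast
qed

section \<open>The sign of the cubic\<close>

text \<open>For fixed \<open>x > d\<close> the cubic is a quadratic polynomial in \<open>y\<close> with its minimum at \<open>y = (d - x) / 2\<close>.
  The constraint \<open>d \<le> x + 2 y\<close> keeps \<open>y\<close> on the increasing branch, so that the following monotonicity
  facts apply.\<close>

lemma cubic_diff:
  "cubic d x y2 - cubic d x y1 = (x - d) * (y2 - y1) * (y1 + y2 + x - d)"
  by (simp add: cubic_def algebra_simps)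

lemma cubic_mono:
  assumes "d \<le> x" "d \<le> x + 2 * y1" "y1 \<le> y2"
  shows "cubic d x y1 \<le> cubic d x y2"
proof -
  have "0 \<le> (x - d) * (y2 - y1) * (y1 + y2 + x - d)" using assms by simp
  then show ?thesis by (simp flip: cubic_diff)
qed

lemma cubic_strict_mono:
  assumes "d < x" "d \<le> x + 2 * y1" "y1 < y2"
  shows "cubic d x y1 < cubic d x y2"
proof -
  have "0 < (x - d) * (y2 - y1) * (y1 + y2 + x - d)" using assms by simp
  then show ?thesis by (simp flip: cubic_diff)
qed

lemma cubic_le_imp_le:
  assumes "d < x" "d \<le> x + 2 * y2" "cubic d x y1 \<le> cubic d x y2"
  shows "y1 \<le> y2"
  using cubic_strict_mono[OF assms(1,2), of y1] assms(3) by linarith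

text \<open>By monotonicity it suffices to treat \<open>y = 0\<close>, where the cubic factors into linear terms.\<close>

lemma cubic_nonpos_of_y_nonpos:
  assumes "d \<le> 0" "d \<le> x" "-1 \<le> x" "x \<le> d + 1" "d \<le> x + 2 * y" "y \<le> 0"
  shows "cubic d x y \<le> 0"
proof -
  have "cubic d x 0 = d * ((d + 1 - x) * (x + 1))" by (simp add: cubic_def algebra_simps)
  also have "\<dots> \<le> 0" using assms by (intro mult_nonpos_nonneg) auto
  finally show ?thesis using cubic_mono[of d x y 0] assms by simp
qed

text \<open>For a given sum \<open>x + y\<close> the product \<open>(x - d) (y - d)\<close> is largest at \<open>x = y\<close>, so the cubic is bounded
  by its value at the corner \<open>x = y = d + 1/2\<close>, which is \<open>d\<^sup>2 + 3/2 d + 1/4\<close>.\<close>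

lemma cubic_nonpos_of_small_sum:
  assumes d: "d \<le> 0" "d\<^sup>2 + 3 / 2 * d + 1 / 4 \<le> 0" and xy: "0 \<le> x + y" "x + y \<le> 2 * d + 1"
  shows "cubic d x y \<le> 0"
proof -
  define t where "t = (x + y) / 2 - d"
  have t2: "2 * t = x + y - 2 * d" by (simp add: t_def)
  have "0 \<le> t" using t2 d(1) xy(1) by linarith
  have "t \<le> 1 / 2" using t2 xy(2) by linarith
  have "(x - d) * (y - d) = t\<^sup>2 - ((x - y) / 2)\<^sup>2"
    by (simp add: t_def power2_eq_square field_simps)
  also have "\<dots> \<le> t\<^sup>2" by simp
  also have "\<dots> \<le> (1 / 2)\<^sup>2" using \<open>0 \<le> t\<close> \<open>t \<le> 1 / 2\<close> by (intro power_mono)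
  finally have "(x - d) * (y - d) \<le> 1 / 4" by (simp add: power2_eq_square)
  then have "(x + y) * ((x - d) * (y - d)) \<le> (x + y) * (1 / 4)"
    using xy(1) by (rule mult_left_mono)
  also have "\<dots> \<le> (2 * d + 1) * (1 / 4)" using xy(2) by simp
  finally show ?thesis using d(2) by (simp add: cubic_def mult.assoc power2_eq_square algebra_simps)
qed

section \<open>The points and the curve on the boundary\<close>

lemma cubic_diagonal: "cubic d x x = 2 * x * (x - d)\<^sup>2 + d * (1 + d)"
  by (simp add: cubic_def power2_eq_square)

text \<open>This is Cardano's formula. In terms of the two cube roots \<open>m\<close> and \<open>n\<close>, whose cubes are
  \<open>(k + s) / 4\<close> and \<open>(k - s) / 4\<close> and whose product is \<open>d\<^sup>2\<close>, the number \<open>f_fun d\<close> equals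
  \<open>(2 d - m - n) / 3\<close>.\<close>

lemma f_fun_root:
  assumes d: "-1 < d" "d \<le> 0"
  shows "cubic d (f_fun d) (f_fun d) = 0"
proof (cases "d = 0")
  case True then show ?thesis by (simp add: f_fun_0 cubic_def)
next
  case False
  define k where "k = 4 * d ^ 3 + 27 * d\<^sup>2 + 27 * d"
  define s where "s = 3 * sqrt 3 * sqrt (d\<^sup>2 * (d + 1) * (8 * d\<^sup>2 + 27 * d + 27))"
  have r: "r_fun d = k + s" by (simp add: r_fun_def k_def s_def)
  have "0 \<le> 8 * d\<^sup>2 + 27 * d + 27" using d zero_le_power2[of d] by linarith
  then have "0 \<le> d\<^sup>2 * (d + 1) * (8 * d\<^sup>2 + 27 * d + 27)"
    using d by (intro mult_nonneg_nonneg) auto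
  then have s2: "s\<^sup>2 = 27 * (d\<^sup>2 * (d + 1) * (8 * d\<^sup>2 + 27 * d + 27))"
    by (simp add: s_def power_mult_distrib)
  \<comment> \<open>The radicand in \<open>r_fun\<close> is such that the two cubes have the product \<open>d\<^sup>6\<close>.\<close>
  have norm: "(k + s) * (k - s) = 16 * d ^ 6"
  proof -
    have "(k + s) * (k - s) = k\<^sup>2 - s\<^sup>2" by (simp add: power2_eq_square algebra_simps)
    also have "\<dots> = 16 * d ^ 6" unfolding s2 k_def by (simp add: eval_nat_numeral algebra_simps)
    finally show ?thesis .
  qed
  then have r0: "k + s \<noteq> 0" using False by auto
  define m where "m = root 3 (k + s) / root 3 4"
  define n where "n = d\<^sup>2 / m"
  have m3: "m ^ 3 = (k + s) / 4" by (simp add: m_def power_divide odd_real_root_pow)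
  then have m0: "m \<noteq> 0" using r0 by auto
  have mn: "m * n = d\<^sup>2" using m0 by (simp add: n_def)
  have "(k + s) * (4 * n ^ 3) = 16 * (m * n) ^ 3" by (simp add: power_mult_distrib m3)
  also have "\<dots> = (k + s) * (k - s)" unfolding norm mn by (simp add: power_mult[symmetric])
  finally have n3: "4 * n ^ 3 = k - s" using r0 by simp
  have f: "f_fun d = (2 * d - (m + n)) / 3"
    unfolding f_fun_def r using r0 by (simp add: m_def n_def field_simps)
  have "(m + n) ^ 3 = m ^ 3 + n ^ 3 + 3 * (m * n) * (m + n)"
    by (simp add: power3_eq_cube algebra_simps)
  moreover have "4 * m ^ 3 = k + s" by (simp add: m3)
  ultimately have u3: "2 * (m + n) ^ 3 = k + 6 * d\<^sup>2 * (m + n)"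
    using n3 unfolding mn by linarith
  have "27 * cubic d (f_fun d) (f_fun d) = 4 * d ^ 3 + 6 * d\<^sup>2 * (m + n) - 2 * (m + n) ^ 3 + 27 * (d * (1 + d))"
    unfolding f cubic_diagonal by (simp add: power2_eq_square power3_eq_cube field_simps)
  also have "\<dots> = 0" unfolding u3 k_def by (simp add: power2_eq_square algebra_simps)
  finally show ?thesis by simp
qed

lemma f_fun_nonneg:
  assumes d: "-1 < d" "d \<le> 0"
  shows "0 \<le> f_fun d"
proof (rule ccontr)
  assume neg: "\<not> 0 \<le> f_fun d"
  then have "d \<noteq> 0" using f_fun_0 by auto
  then have "d * (1 + d) < 0" using d by (intro mult_neg_pos) auto
  moreover have "2 * f_fun d * (f_fun d - d)\<^sup>2 \<le> 0" by (rule mult_nonpos_nonneg) (use neg in auto)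
  ultimately show False using f_fun_root[OF d] by (simp add: cubic_diagonal)
qed

text \<open>The diagonal value increases strictly for \<open>x \<ge> 0\<close> and is nonpositive for \<open>x \<le> 0\<close>, so its sign
  changes only at the root \<open>f_fun d\<close>.\<close>

lemma cubic_diagonal_nonpos_iff:
  assumes d: "-1 < d" "d \<le> 0"
  shows "cubic d x x \<le> 0 \<longleftrightarrow> x \<le> f_fun d"
proof
  assume x: "x \<le> f_fun d"
  show "cubic d x x \<le> 0"
  proof (cases "0 \<le> x")
    case True
    then have "2 * x * (x - d)\<^sup>2 \<le> 2 * f_fun d * (f_fun d - d)\<^sup>2"
      using x d by (intro mult_mono power_mono) auto
    then show ?thesis using f_fun_root[OF d] by (simp add: cubic_diagonal)
  next
    case False
    then have "2 * x * (x - d)\<^sup>2 \<le> 0" by (intro mult_nonpos_nonneg[of "2 * x"]) auto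
    moreover have "d * (1 + d) \<le> 0" using d by (intro mult_nonpos_nonneg) auto
    ultimately show ?thesis by (simp add: cubic_diagonal)
  qed
next
  assume le: "cubic d x x \<le> 0"
  show "x \<le> f_fun d"
  proof (rule ccontr)
    assume "\<not> x \<le> f_fun d"
    then have x: "f_fun d < x" "0 < x" using f_fun_nonneg[OF d] by auto
    have "2 * f_fun d * (f_fun d - d)\<^sup>2 \<le> 2 * f_fun d * (x - d)\<^sup>2"
      using x d f_fun_nonneg[OF d] by (intro mult_left_mono power_mono) auto
    also have "\<dots> < 2 * x * (x - d)\<^sup>2"
      using x d by (intro mult_strict_right_mono) auto
    finally show False using le f_fun_root[OF d] by (simp add: cubic_diagonal)
  qed
qed

lemma f_fun_le_of_cubic_nonneg:
  assumes d: "-1 < d" "d \<le> 0" and x: "0 \<le> cubic d x x"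
  shows "f_fun d \<le> x"
proof (rule ccontr)
  assume less: "\<not> f_fun d \<le> x"
  show False
  proof (cases "0 \<le> x")
    case True
    have "2 * x * (x - d)\<^sup>2 \<le> 2 * x * (f_fun d - d)\<^sup>2"
      using less True d by (intro mult_left_mono power_mono) auto
    also have "\<dots> < 2 * f_fun d * (f_fun d - d)\<^sup>2"
      using less True d by (intro mult_strict_right_mono) auto
    finally show False using x f_fun_root[OF d] by (simp add: cubic_diagonal)
  next
    case False
    have "cubic d x x < 0"
    proof (cases "x = d")
      case True
      then show ?thesis using False d by (simp add: cubic_def mult_less_0_iff)
    next
      case noteq: False
      then have "2 * x * (x - d)\<^sup>2 < 0" using False by (simp add: mult_less_0_iff)
      moreover have "d * (1 + d) \<le> 0" using d by (intro mult_nonpos_nonneg) auto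
      ultimately show ?thesis by (simp add: cubic_diagonal)
    qed
    with x show False by simp
  qed
qed

lemma g_fun_radicand:
  "(d - (-3/4 + sqrt 5 / 4)) * (d - (-3/4 - sqrt 5 / 4)) = d\<^sup>2 + 3 / 2 * d + 1 / 4"
  by (simp add: power2_eq_square field_simps)

lemma g_fun_facts:
  assumes d: "-1/2 < d" "d \<le> 0" "0 \<le> d\<^sup>2 + 3 / 2 * d + 1 / 4"
  shows "0 \<le> g_fun d" "g_fun d \<le> 1 / 2" "(2 * d + 1) * (g_fun d)\<^sup>2 = d\<^sup>2 + 3 / 2 * d + 1 / 4"
proof -
  have g2: "(g_fun d)\<^sup>2 = (d\<^sup>2 + 3 / 2 * d + 1 / 4) / (2 * d + 1)"
    unfolding g_fun_def g_fun_radicand using d by simp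
  then show *: "(2 * d + 1) * (g_fun d)\<^sup>2 = d\<^sup>2 + 3 / 2 * d + 1 / 4" using d by simp
  show "0 \<le> g_fun d" unfolding g_fun_def g_fun_radicand using d by simp
  have "d\<^sup>2 + d \<le> 0" using d mult_nonpos_nonneg[of d "d + 1"] by (simp add: power2_eq_square algebra_simps)
  then have "(2 * d + 1) * (g_fun d)\<^sup>2 \<le> (2 * d + 1) * (1 / 2)\<^sup>2"
    unfolding * by (simp add: power2_eq_square field_simps)
  then have "(g_fun d)\<^sup>2 \<le> (1 / 2)\<^sup>2" using d by (simp only: mult_le_cancel_left_pos)
  then show "g_fun d \<le> 1 / 2" by (rule power2_le_imp_le) simp
qed

text \<open>On the line \<open>x + y = 2 d + 1\<close> the cubic is quadratic in the distance from the point \<open>B\<close>, which is why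
  \<open>g_fun d\<close> marks the point \<open>I\<close>.\<close>

lemma cubic_antidiagonal:
  assumes d: "-1/2 < d" "d \<le> 0" "0 \<le> d\<^sup>2 + 3 / 2 * d + 1 / 4"
  shows "cubic d x (2 * d + 1 - x) = (2 * d + 1) * ((g_fun d)\<^sup>2 - (x - (d + 1 / 2))\<^sup>2)"
  using g_fun_facts(3)[OF d]
  by (simp add: right_diff_distrib[of "2 * d + 1"] cubic_def power2_eq_square field_simps)

lemma cubic_antidiagonal_nonneg_iff:
  assumes d: "-1/2 < d" "d \<le> 0" "0 \<le> d\<^sup>2 + 3 / 2 * d + 1 / 4"
  shows "0 \<le> cubic d x (2 * d + 1 - x) \<longleftrightarrow> \<bar>x - (d + 1 / 2)\<bar> \<le> g_fun d"
  using d g_fun_facts(1)[OF d]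
  by (simp add: cubic_antidiagonal[OF d] zero_le_mult_iff abs_le_square_iff[symmetric])

lemma cubic_antidiagonal_nonpos_iff:
  assumes d: "-1/2 < d" "d \<le> 0" "0 \<le> d\<^sup>2 + 3 / 2 * d + 1 / 4"
  shows "cubic d x (2 * d + 1 - x) \<le> 0 \<longleftrightarrow> g_fun d \<le> \<bar>x - (d + 1 / 2)\<bar>"
  using d g_fun_facts(1)[OF d]
  by (simp add: cubic_antidiagonal[OF d] mult_le_0_iff abs_le_square_iff[symmetric])

text \<open>\<open>h_fun d x\<close> is the larger root of the quadratic polynomial \<open>cubic d x\<close>. Its radicand is nonnegative
  because \<open>x - d\<close> and \<open>- d (1 + d)\<close> are.\<close>

lemma h_fun_root:
  assumes d: "-1 \<le> d" "d \<le> 0" and x: "0 \<le> x"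
  shows "cubic d x (h_fun d x) = 0" "d \<le> x + 2 * h_fun d x"
proof -
  define D where "D = (x ^ 3 + d * x\<^sup>2 - d\<^sup>2 * x - 4 * d - 4 * d\<^sup>2 - d ^ 3) / (x - d)"
  have h: "2 * h_fun d x + (x - d) = sqrt D" by (simp add: h_fun_def D_def)
  have eq: "x ^ 3 + d * x\<^sup>2 - d\<^sup>2 * x - 4 * d - 4 * d\<^sup>2 - d ^ 3 = (x + d)\<^sup>2 * (x - d) + (- d) * (4 * (1 + d))"
    by (simp add: power2_eq_square power3_eq_cube algebra_simps)
  have "0 \<le> (x + d)\<^sup>2 * (x - d)" by (rule mult_nonneg_nonneg) (use d x in auto)
  moreover have "0 \<le> (- d) * (4 * (1 + d))" by (rule mult_nonneg_nonneg) (use d in auto)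
  ultimately have "0 \<le> (x + d)\<^sup>2 * (x - d) + (- d) * (4 * (1 + d))" by (rule add_nonneg_nonneg)
  then have D0: "0 \<le> D"
    unfolding D_def eq by (rule divide_nonneg_nonneg) (use d x in simp)
  then show "d \<le> x + 2 * h_fun d x" using h real_sqrt_ge_zero[of D] by linarith
  show "cubic d x (h_fun d x) = 0"
  proof (cases "x = d")
    case True
    then have "d = 0" "x = 0" using d x by auto
    then show ?thesis by (simp add: cubic_def h_fun_0)
  next
    case False
    have "4 * cubic d x y = (x - d) * ((2 * y + (x - d))\<^sup>2) - ((x + d)\<^sup>2 * (x - d) + (- d) * (4 * (1 + d)))" for y
      by (simp add: cubic_def power2_eq_square algebra_simps)
    from this[of "h_fun d x"] have "4 * cubic d x (h_fun d x) = (x - d) * D - ((x + d)\<^sup>2 * (x - d) + (- d) * (4 * (1 + d)))"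
      unfolding h using D0 by simp
    also have "\<dots> = 0" unfolding D_def eq using False by simp
    finally show ?thesis by simp
  qed
qed

lemma h_fun_unique:
  assumes d: "-1 \<le> d" "d \<le> 0" and x: "0 \<le> x" and y: "y \<le> x" "d \<le> x + 2 * y" "cubic d x y = 0"
  shows "y = h_fun d x"
proof (cases "x = d")
  case True
  then have "d = 0" "x = 0" using d x by auto
  then show ?thesis using y h_fun_0[of 0] by simp
next
  case False
  then have "d < x" using d x by simp
  then show ?thesis
    using cubic_le_imp_le[of d x y "h_fun d x"] cubic_le_imp_le[of d x "h_fun d x" y] y h_fun_root[OF d x]
    by simp
qed



section \<open>The triangle and the quadrangle\<close>

text \<open>For \<open>d > -3/4\<close> the slacks of the three inequalities, scaled by their values at the opposite vertices,
  are the barycentric coordinates; for \<open>d = -3/4\<close> the triangle is a point.\<close>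

lemma triangle_ABC_eq:
  assumes "-3/4 \<le> d"
  shows "triangle_ABC d = {(x, y). y \<le> x \<and> d \<le> x + 2 * y \<and> x + y \<le> 2 * d + 1}" (is "_ = ?T")
proof
  have T: "?T = {p. (-1, 1) \<bullet> p \<le> 0} \<inter> {p. (-1, -2) \<bullet> p \<le> - d} \<inter> {p. (1, 1) \<bullet> p \<le> 2 * d + 1}"
    by (auto simp: inner_prod_def)
  have "convex ?T" unfolding T by (intro convex_Int convex_halfspace_le)
  then show "triangle_ABC d \<subseteq> ?T"
    unfolding triangle_ABC_def
    by (intro hull_minimal) (use assms in \<open>auto simp: pt_A_def pt_B_def pt_C_def\<close>)
  show "?T \<subseteq> triangle_ABC d"
  proof
    fix p assume "p \<in> {(x, y). y \<le> x \<and> d \<le> x + 2 * y \<and> x + y \<le> 2 * d + 1}"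
    then obtain x y where p: "p = (x, y)" and xy: "y \<le> x" "d \<le> x + 2 * y" "x + y \<le> 2 * d + 1" by auto
    show "p \<in> triangle_ABC d"
    proof (cases "d = -3/4")
      case True
      then have "x = d / 3" "y = d / 3" using xy by auto
      then have "p = pt_A d" by (simp add: p pt_A_def)
      then show ?thesis unfolding triangle_ABC_def by (simp add: hull_inc)
    next
      case False
      define s where "s = 4 * d + 3"
      have s: "0 < s" using False assms by (simp add: s_def)
      define u v w where "u = 3 * (2 * d + 1 - x - y) / s" and "v = 2 * (x + 2 * y - d) / s" and "w = (x - y) / s"
      have nonneg: "0 \<le> u" "0 \<le> v" "0 \<le> w" using xy s by (auto simp: u_def v_def w_def)
      have us: "u * s = 3 * (2 * d + 1 - x - y)" "v * s = 2 * (x + 2 * y - d)" "w * s = x - y"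
        using s by (simp_all add: u_def v_def w_def)
      have "(u + v + w) * s = s" unfolding distrib_right us by (simp add: s_def)
      then have sum: "u + v + w = 1" using s by simp
      have comb: "s * (u * (d / 3) + v * e + w * g)
          = (2 * d + 1 - x - y) * d + (x + 2 * y - d) * (2 * e) + (x - y) * g" for e g
      proof -
        have "s * (u * (d / 3) + v * e + w * g) = (u * s) * (d / 3) + (v * s) * e + (w * s) * g"
          by (simp add: algebra_simps)
        also have "(u * s) * (d / 3) = (2 * d + 1 - x - y) * d" unfolding us by simp
        also have "(v * s) * e = (x + 2 * y - d) * (2 * e)" unfolding us by simp
        also have "(w * s) * g = (x - y) * g" unfolding us ..
        finally show ?thesis .
      qed
      have "s * (u * (d / 3) + v * (d + 1 / 2) + w * (3 * d + 2)) = s * x"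
        unfolding comb by (simp add: s_def algebra_simps)
      then have "x = u * (d / 3) + v * (d + 1 / 2) + w * (3 * d + 2)" using s by simp
      moreover have "s * (u * (d / 3) + v * (d + 1 / 2) + w * (- d - 1)) = s * y"
        unfolding comb by (simp add: s_def algebra_simps)
      then have "y = u * (d / 3) + v * (d + 1 / 2) + w * (- d - 1)" using s by simp
      ultimately have "p = u *\<^sub>R pt_A d + v *\<^sub>R pt_B d + w *\<^sub>R pt_C d"
        by (simp add: p pt_A_def pt_B_def pt_C_def)
      then show ?thesis using nonneg sum unfolding triangle_ABC_def convex_hull_3 by blast
    qed
  qed
qed

lemma closed_segment_graph:
  fixes m q :: real
  assumes "a \<le> b"
  shows "closed_segment (a, m * a + q) (b, m * b + q) = (\<lambda>x. (x, m * x + q)) ` {a..b}"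
proof -
  have "closed_segment (a, m * a + q) (b, m * b + q) = (\<lambda>x. (x, m * x + q)) ` closed_segment a b"
    unfolding closed_segment_image_interval image_image by (simp add: algebra_simps)
  then show ?thesis using assms by (simp add: closed_segment_eq_real_ivl)
qed

lemma closed_segment_vertical:
  fixes a b c :: real
  assumes "a \<le> b"
  shows "closed_segment (c, a) (c, b) = Pair c ` {a..b}"
proof -
  have "closed_segment (c, a) (c, b) = Pair c ` closed_segment a b"
    unfolding closed_segment_image_interval image_image by (simp add: algebra_simps)
  then show ?thesis using assms by (simp add: closed_segment_eq_real_ivl)
qed

text \<open>A point satisfying the inequalities lies on a vertical segment with its lower end on the edge \<open>AG\<close> and
  its upper end on one of the edges \<open>AB\<close> and \<open>BF\<close>.\<close>

lemma quadrangle_ABFG_eq: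
  assumes d: "-1/2 \<le> d" "d \<le> 0"
  shows "quadrangle_ABFG d = {(x, y). y \<le> x \<and> d \<le> x + 2 * y \<and> x + y \<le> 2 * d + 1 \<and> x \<le> d + 1}"
    (is "_ = ?Q")
proof
  have Q: "?Q = {p. (-1, 1) \<bullet> p \<le> 0} \<inter> {p. (-1, -2) \<bullet> p \<le> - d} \<inter> {p. (1, 1) \<bullet> p \<le> 2 * d + 1}
      \<inter> {p. (1, 0) \<bullet> p \<le> d + 1}"
    by (auto simp: inner_prod_def)
  have "convex ?Q" unfolding Q by (intro convex_Int convex_halfspace_le)
  then show "quadrangle_ABFG d \<subseteq> ?Q"
    unfolding quadrangle_ABFG_def
    by (intro hull_minimal) (use d in \<open>auto simp: pt_A_def pt_B_def pt_F_def pt_G_def\<close>)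
  have seg: "closed_segment P R \<subseteq> quadrangle_ABFG d"
    if "P \<in> quadrangle_ABFG d" "R \<in> quadrangle_ABFG d" for P R
    using that convex_contains_segment[of "quadrangle_ABFG d"]
    by (auto simp: quadrangle_ABFG_def convex_convex_hull)
  have vert: "pt_A d \<in> quadrangle_ABFG d" "pt_B d \<in> quadrangle_ABFG d" "pt_F d \<in> quadrangle_ABFG d"
    "pt_G d \<in> quadrangle_ABFG d" by (auto simp: quadrangle_ABFG_def hull_inc)
  have AB: "(x, x) \<in> quadrangle_ABFG d" if "d / 3 \<le> x" "x \<le> d + 1 / 2" for x
    using seg[OF vert(1,2)] closed_segment_graph[of "d / 3" "d + 1 / 2" 1 0] that d
    by (auto simp: pt_A_def pt_B_def)
  have BF: "(x, 2 * d + 1 - x) \<in> quadrangle_ABFG d" if "d + 1 / 2 \<le> x" "x \<le> d + 1" for x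
    using seg[OF vert(2,3)] closed_segment_graph[of "d + 1 / 2" "d + 1" "-1" "2 * d + 1"] that d
    by (auto simp: pt_B_def pt_F_def)
  have AG: "(x, (d - x) / 2) \<in> quadrangle_ABFG d" if "d / 3 \<le> x" "x \<le> d + 1" for x
  proof -
    have G: "pt_A d = (d / 3, -1/2 * (d / 3) + d / 2)" "pt_G d = (d + 1, -1/2 * (d + 1) + d / 2)"
      by (simp_all add: pt_A_def pt_G_def field_simps)
    have "(x, -1/2 * x + d / 2) \<in> quadrangle_ABFG d"
      using seg[OF vert(1,4)] closed_segment_graph[of "d / 3" "d + 1" "-1/2" "d / 2"] that d
      unfolding G by auto
    then show ?thesis by (simp add: diff_divide_distrib)
  qed
  show "?Q \<subseteq> quadrangle_ABFG d"
  proof (clarify)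
    fix x y assume xy: "y \<le> x" "d \<le> x + 2 * y" "x + y \<le> 2 * d + 1" "x \<le> d + 1"
    define top where "top = min x (2 * d + 1 - x)"
    have "(x, top) \<in> quadrangle_ABFG d"
    proof (cases "x \<le> d + 1 / 2")
      case True
      then show ?thesis using AB[of x] xy by (simp add: top_def min_def)
    next
      case False
      then show ?thesis using BF[of x] xy by (simp add: top_def min_def)
    qed
    moreover have "(x, (d - x) / 2) \<in> quadrangle_ABFG d" using AG[of x] xy by simp
    moreover have "(d - x) / 2 \<le> y" "y \<le> top" using xy by (auto simp: top_def)
    ultimately show "(x, y) \<in> quadrangle_ABFG d"
      using seg[of "(x, (d - x) / 2)" "(x, top)"] closed_segment_vertical[of "(d - x) / 2" top x] by auto
  qed
qed

section \<open>The region bounded by the curve\<close>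

text \<open>The component of a point of \<open>S\<close> in the complement of \<open>B\<close> cannot cross the frontier of \<open>S\<close>, so it
  stays in the bounded set \<open>S\<close>. The component of a point outside \<open>S\<close> contains a ray, so it is
  unbounded.\<close>

lemma outline_union_inside:
  fixes S B :: "'a :: real_normed_vector set"
  assumes S: "bounded S" and sub: "B \<subseteq> S" and front: "frontier S \<subseteq> B"
    and escape: "\<And>p. p \<notin> S \<Longrightarrow> \<exists>v. v \<noteq> 0 \<and> (\<forall>t\<ge>0. p + t *\<^sub>R v \<notin> S)"
  shows "B \<union> inside B = S"
proof (intro equalityI subsetI)
  fix p assume p: "p \<in> B \<union> inside B"
  show "p \<in> S"
  proof (rule ccontr)
    assume pS: "p \<notin> S"
    then have pB: "bounded (connected_component_set (- B) p)" using p sub by (auto simp: inside_def)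
    obtain v where v: "v \<noteq> 0" "\<And>t. t \<ge> 0 \<Longrightarrow> p + t *\<^sub>R v \<notin> S" using escape[OF pS] by blast
    define R where "R = (\<lambda>t. p + t *\<^sub>R v) ` {0..}"
    have "connected R" unfolding R_def
      by (intro connected_continuous_image continuous_intros) (simp add: is_interval_connected is_interval_ci)
    moreover have "p \<in> R" unfolding R_def by (rule image_eqI[of _ _ 0]) auto
    moreover have "R \<subseteq> - B" using v(2) sub by (auto simp: R_def)
    ultimately have "R \<subseteq> connected_component_set (- B) p" by (intro connected_component_maximal)
    then have "bounded R" using pB bounded_subset by blast
    then obtain K where K: "\<And>t. t \<ge> 0 \<Longrightarrow> norm (p + t *\<^sub>R v) \<le> K" by (auto simp: R_def bounded_iff)
    \<comment> \<open>At this parameter the ray has left the ball of radius \<open>K\<close>.\<close>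
    define t where "t = (\<bar>K\<bar> + norm p + 1) / norm v"
    have "t * norm v = \<bar>K\<bar> + norm p + 1" "0 \<le> t" using v(1) by (auto simp: t_def)
    then have "norm (t *\<^sub>R v) = \<bar>K\<bar> + norm p + 1" by simp
    moreover have "norm (t *\<^sub>R v) \<le> norm (p + t *\<^sub>R v) + norm p"
      using norm_triangle_ineq4[of "p + t *\<^sub>R v" p] by simp
    ultimately show False using K[OF \<open>0 \<le> t\<close>] by simp
  qed
next
  fix p assume p: "p \<in> S"
  show "p \<in> B \<union> inside B"
  proof (cases "p \<in> B")
    case False
    define C where "C = connected_component_set (- B) p"
    have "connected C" "p \<in> C" "C \<subseteq> - B"
      using False by (auto simp: C_def connected_component_subset connected_component_refl_eq)
    moreover have "C \<subseteq> S"
    proof (rule ccontr)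
      assume "\<not> C \<subseteq> S"
      then have "C \<inter> frontier S \<noteq> {}"
        using p \<open>p \<in> C\<close> \<open>connected C\<close> by (intro connected_Int_frontier) auto
      then show False using front \<open>C \<subseteq> - B\<close> by blast
    qed
    then have "bounded C" using S bounded_subset by blast
    ultimately show ?thesis using False by (simp add: inside_def C_def)
  qed auto
qed


text \<open>The five edges of the shape \<open>P\<close>, the sloping ones as graphs over the \<open>x\<close>-axis.\<close>

definition outline_P :: "real \<Rightarrow> (real \<times> real) set" where
  "outline_P d = (\<lambda>x. (x, x)) ` {d / 3..f_fun d} \<union>
     (\<lambda>x. (x, h_fun d x)) ` {f_fun d..d + 1 / 2 + g_fun d} \<union>
     (\<lambda>x. (x, 2 * d + 1 - x)) ` {d + 1 / 2 + g_fun d..d + 1} \<union>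
     Pair (d + 1) ` {-1/2..d} \<union>
     (\<lambda>x. (x, (d - x) / 2)) ` {d / 3..d + 1}"

text \<open>The point \<open>H\<close> does not lie beyond \<open>B\<close> on the diagonal, and its abscissa belongs to the interval around
  \<open>d + 1/2\<close> on which the cubic is nonnegative along the line \<open>x + y = 2 d + 1\<close>. Hence this holds for
  all abscissas between \<open>H\<close> and \<open>I\<close>.\<close>

lemma f_fun_bounds:
  assumes d: "-1/2 < d" "d \<le> 0" "0 \<le> d\<^sup>2 + 3 / 2 * d + 1 / 4"
  shows "f_fun d \<le> d + 1 / 2" "d + 1 / 2 - f_fun d \<le> g_fun d"
proof -
  have "0 \<le> cubic d (d + 1 / 2) (d + 1 / 2)"
    using d(3) by (simp add: cubic_def power2_eq_square algebra_simps)
  then show le: "f_fun d \<le> d + 1 / 2" using d by (intro f_fun_le_of_cubic_nonneg) auto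
  have "cubic d (f_fun d) (f_fun d) \<le> cubic d (f_fun d) (2 * d + 1 - f_fun d)"
    using le f_fun_nonneg[of d] d by (intro cubic_mono) auto
  then have "0 \<le> cubic d (f_fun d) (2 * d + 1 - f_fun d)" using f_fun_root[of d] d by simp
  then show "d + 1 / 2 - f_fun d \<le> g_fun d" using cubic_antidiagonal_nonneg_iff[OF d] by simp
qed

text \<open>The curve joins \<open>H\<close> to \<open>I\<close> since both lie on the zero set of the cubic, of which \<open>h_fun d\<close> describes
  the relevant branch.\<close>

lemma path_image_boundary_P:
  assumes d: "-1/2 < d" "d \<le> 0" "0 \<le> d\<^sup>2 + 3 / 2 * d + 1 / 4"
  shows "path_image (boundary_P d) = outline_P d"
proof -
  define f where "f = f_fun d"
  define b where "b = d + 1 / 2 + g_fun d"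
  have f: "0 \<le> f" "f \<le> d + 1 / 2" "f \<le> b" and b: "d + 1 / 2 \<le> b" "b \<le> d + 1"
    using f_fun_nonneg[of d] f_fun_bounds[OF d] g_fun_facts[OF d] d by (auto simp: f_def b_def)
  have hf: "h_fun d f = f"
    using h_fun_unique[of d f f] f_fun_root[of d] f d by (simp add: f_def)
  have "cubic d b (2 * d + 1 - b) = 0"
    unfolding cubic_antidiagonal[OF d] by (simp add: b_def)
  then have hb: "h_fun d b = 2 * d + 1 - b"
    using h_fun_unique[of d b "2 * d + 1 - b"] b f d by simp
  have curve: "path_image (gamma_curve d) = (\<lambda>x. (x, h_fun d x)) ` {f..b}"
  proof -
    have "x_curve d ` {0..1} = closed_segment f b"
      unfolding closed_segment_image_interval by (simp add: x_curve_def f_def b_def)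
    then have "x_curve d ` {0..1} = {f..b}" using f by (simp add: closed_segment_eq_real_ivl)
    then have "(\<lambda>x. (x, h_fun d x)) ` (x_curve d ` {0..1}) = (\<lambda>x. (x, h_fun d x)) ` {f..b}" by simp
    then show ?thesis by (simp add: path_image_def gamma_curve_def[abs_def] image_image)
  qed
  have ends: "pathstart (gamma_curve d) = pt_H d" "pathfinish (gamma_curve d) = pt_I d"
    using hf hb by (simp_all add: pathstart_def pathfinish_def gamma_curve_def x_curve_def pt_H_def pt_I_def f_def b_def)
  have "path_image (boundary_P d) = closed_segment (pt_A d) (pt_H d) \<union> (path_image (gamma_curve d) \<union>
      (closed_segment (pt_I d) (pt_F d) \<union> (closed_segment (pt_F d) (pt_G d) \<union> closed_segment (pt_G d) (pt_A d))))"
    unfolding boundary_P_def by (simp add: path_image_join ends)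
  moreover have "closed_segment (pt_A d) (pt_H d) = (\<lambda>x. (x, x)) ` {d / 3..f}"
    using closed_segment_graph[of "d / 3" f 1 0] f d by (simp add: pt_A_def pt_H_def f_def)
  moreover have "closed_segment (pt_I d) (pt_F d) = (\<lambda>x. (x, 2 * d + 1 - x)) ` {b..d + 1}"
    using closed_segment_graph[of b "d + 1" "-1" "2 * d + 1"] b
    by (simp add: pt_I_def pt_F_def b_def algebra_simps)
  moreover have "closed_segment (pt_F d) (pt_G d) = Pair (d + 1) ` {-1/2..d}"
    using closed_segment_vertical[of "-1/2" d "d + 1"] d
    by (simp add: pt_F_def pt_G_def closed_segment_commute)
  moreover have "closed_segment (pt_G d) (pt_A d) = (\<lambda>x. (x, (d - x) / 2)) ` {d / 3..d + 1}"
  proof -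
    have G: "pt_A d = (d / 3, -1/2 * (d / 3) + d / 2)" "pt_G d = (d + 1, -1/2 * (d + 1) + d / 2)"
      by (simp_all add: pt_A_def pt_G_def field_simps)
    have "closed_segment (pt_G d) (pt_A d) = (\<lambda>x. (x, -1/2 * x + d / 2)) ` {d / 3..d + 1}"
      unfolding G closed_segment_commute[of "(d + 1, _)"] using d by (intro closed_segment_graph) simp
    also have "\<dots> = (\<lambda>x. (x, (d - x) / 2)) ` {d / 3..d + 1}"
      by (intro image_cong) (auto simp: field_simps)
    finally show ?thesis .
  qed
  ultimately show ?thesis unfolding curve by (simp add: outline_P_def f_def b_def Un_assoc)
qed

lemma outline_P_subset:
  assumes d: "-1/2 < d" "d \<le> 0" "0 \<le> d\<^sup>2 + 3 / 2 * d + 1 / 4"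
  shows "outline_P d \<subseteq> spectral_region d"
proof -
  define f where "f = f_fun d"
  define b where "b = d + 1 / 2 + g_fun d"
  have f: "0 \<le> f" "f \<le> d + 1 / 2" "d + 1 / 2 - f \<le> g_fun d" and b: "d + 1 / 2 \<le> b" "b \<le> d + 1"
    using f_fun_nonneg[of d] f_fun_bounds[OF d] g_fun_facts[OF d] d by (auto simp: f_def b_def)
  have "(x, x) \<in> spectral_region d" if "d / 3 \<le> x" "x \<le> f" for x
    using that cubic_diagonal_nonpos_iff[of d x] d f by (simp add: spectral_region_def f_def)
  moreover have "(x, h_fun d x) \<in> spectral_region d" if x: "f \<le> x" "x \<le> b" for x
  proof -
    have x0: "0 \<le> x" using x f by simp
    note h = h_fun_root[of d x, OF _ d(2) x0]
    have hx: "h_fun d x \<le> x"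
    proof (cases "x = d")
      case True
      then have "d = 0" "x = 0" using d x0 by auto
      then show ?thesis using h_fun_0[of 0] by simp
    next
      case False
      have "0 \<le> cubic d x x"
        using cubic_diagonal_nonpos_iff[of d x] f_fun_root[of d] x d by (cases "x = f") (auto simp: f_def)
      then show ?thesis using cubic_le_imp_le[of d x x "h_fun d x"] False h x0 d by simp
    qed
    have "\<bar>x - (d + 1 / 2)\<bar> \<le> g_fun d" using x f by (auto simp: b_def)
    then have "0 \<le> cubic d x (2 * d + 1 - x)" using cubic_antidiagonal_nonneg_iff[OF d] by simp
    then have "h_fun d x \<le> 2 * d + 1 - x" if "d < x"
      using cubic_le_imp_le[of d x "2 * d + 1 - x" "h_fun d x"] that h x b d by simp
    moreover have "h_fun d x \<le> 2 * d + 1 - x" if "\<not> d < x"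
    proof -
      have "d = 0" "x = 0" using that d x0 by auto
      then show ?thesis using h_fun_0[of 0] by simp
    qed
    ultimately have "h_fun d x \<le> 2 * d + 1 - x" by blast
    then show ?thesis using hx h x b d by (simp add: spectral_region_def)
  qed
  moreover have "(x, 2 * d + 1 - x) \<in> spectral_region d" if "b \<le> x" "x \<le> d + 1" for x
    using that b d cubic_antidiagonal_nonpos_iff[OF d, of x] by (simp add: spectral_region_def b_def)
  moreover have "(d + 1, y) \<in> spectral_region d" if y: "-1/2 \<le> y" "y \<le> d" for y
  proof -
    have "cubic d (d + 1) y = y * (y + 1)" by (simp add: cubic_def algebra_simps)
    also have "\<dots> \<le> 0" using y d by (intro mult_nonpos_nonneg) auto
    finally show ?thesis using y d by (simp add: spectral_region_def)
  qed
  moreover have "(x, (d - x) / 2) \<in> spectral_region d" if x: "d / 3 \<le> x" "x \<le> d + 1" for x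
  proof -
    define y where "y = (d - x) / 2"
    have y: "2 * y = d - x" by (simp add: y_def)
    then have "y \<le> 0" "y \<le> x" "x + y \<le> 2 * d + 1" "d \<le> x + 2 * y" using x d(1,2) by auto
    moreover from this have "cubic d x y \<le> 0" using x d by (intro cubic_nonpos_of_y_nonpos) auto
    ultimately show ?thesis using x unfolding y_def[symmetric] by (simp add: spectral_region_def)
  qed
  ultimately show ?thesis by (auto simp: outline_P_def f_def b_def)
qed

text \<open>Each of the five edges is the part of the region on which one of the five constraints is tight. On
  the curve, comparison along the vertical line with the diagonal and with the antidiagonal shows that
  \<open>x\<close> lies between the abscissas of \<open>H\<close> and \<open>I\<close>.\<close>

lemma tight_constraint_in_outline_P:
  assumes d: "-1/2 < d" "d \<le> 0" "0 \<le> d\<^sup>2 + 3 / 2 * d + 1 / 4"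
    and p: "(x, y) \<in> spectral_region d"
    and tight: "y = x \<or> d = x + 2 * y \<or> x + y = 2 * d + 1 \<or> x = d + 1 \<or> cubic d x y = 0"
  shows "(x, y) \<in> outline_P d"
proof -
  have xy: "y \<le> x" "d \<le> x + 2 * y" "x + y \<le> 2 * d + 1" "x \<le> d + 1" and c: "cubic d x y \<le> 0"
    using p by (auto simp: spectral_region_def)
  have dx: "d / 3 \<le> x" using xy by simp
  from tight consider "y = x" | "d = x + 2 * y" | "x + y = 2 * d + 1" | "x = d + 1" | "cubic d x y = 0"
    by blast
  then show ?thesis
  proof cases
    case 1
    then have "x \<in> {d / 3..f_fun d}" using cubic_diagonal_nonpos_iff[of d x] c dx d by simp
    with 1 show ?thesis by (auto simp: outline_P_def)
  next
    case 2
    then have "y = (d - x) / 2" "x \<in> {d / 3..d + 1}" using dx xy by auto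
    then show ?thesis by (auto simp: outline_P_def)
  next
    case 3
    then have y: "y = 2 * d + 1 - x" by simp
    then have "g_fun d \<le> \<bar>x - (d + 1 / 2)\<bar>" using c cubic_antidiagonal_nonpos_iff[OF d] by simp
    then have "x \<in> {d + 1 / 2 + g_fun d..d + 1}" using xy y by auto
    with y show ?thesis by (auto simp: outline_P_def)
  next
    case 4
    then have "y \<in> {-1/2..d}" using xy by auto
    with 4 show ?thesis by (auto simp: outline_P_def)
  next
    case 5
    have "cubic d x y \<le> cubic d x x" using dx xy d by (intro cubic_mono) auto
    then have fx: "f_fun d \<le> x" using 5 dx d by (intro f_fun_le_of_cubic_nonneg) auto
    have "cubic d x y \<le> cubic d x (2 * d + 1 - x)" using dx xy d by (intro cubic_mono) auto
    then have "\<bar>x - (d + 1 / 2)\<bar> \<le> g_fun d" using 5 cubic_antidiagonal_nonneg_iff[OF d] by simp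
    moreover have "0 \<le> x" using fx f_fun_nonneg[of d] d by simp
    then have "y = h_fun d x" using h_fun_unique[of d x y] xy 5 d by simp
    ultimately show ?thesis using fx by (auto simp: outline_P_def)
  qed
qed

lemma frontier_spectral_region:
  assumes d: "-1/2 < d" "d \<le> 0" "0 \<le> d\<^sup>2 + 3 / 2 * d + 1 / 4"
  shows "frontier (spectral_region d) \<subseteq> outline_P d"
proof
  define U where "U = {p. snd p < fst p \<and> d < fst p + 2 * snd p \<and> fst p + snd p < 2 * d + 1 \<and>
    fst p < d + 1 \<and> cubic d (fst p) (snd p) < 0}"
  have S: "spectral_region d = {p. snd p \<le> fst p \<and> d \<le> fst p + 2 * snd p \<and> fst p + snd p \<le> 2 * d + 1 \<and>
    fst p \<le> d + 1 \<and> cubic d (fst p) (snd p) \<le> 0}" by (auto simp: spectral_region_def)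
  have "closed (spectral_region d)" unfolding S cubic_def
    by (intro closed_Collect_conj closed_Collect_le continuous_intros)
  then have closure: "closure (spectral_region d) = spectral_region d" by simp
  have "open U" unfolding U_def cubic_def
    by (intro open_Collect_conj open_Collect_less continuous_intros)
  moreover have "U \<subseteq> spectral_region d" unfolding U_def S by auto
  ultimately have "U \<subseteq> interior (spectral_region d)" by (rule interior_maximal[rotated])
  fix p assume "p \<in> frontier (spectral_region d)"
  then have "p \<in> spectral_region d" "p \<notin> U"
    using \<open>U \<subseteq> interior (spectral_region d)\<close> by (auto simp: frontier_def closure)
  then show "p \<in> outline_P d"
    using tight_constraint_in_outline_P[OF d, of "fst p" "snd p"] by (force simp: U_def S)
qed

text \<open>A violated linear constraint stays violated along a suitable straight ray. If only the cubic is
  positive, it remains so on the vertical ray upwards, by monotonicity.\<close>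

lemma spectral_region_escape:
  assumes "-1 \<le> d" "d \<le> 0" "p \<notin> spectral_region d"
  shows "\<exists>v. v \<noteq> 0 \<and> (\<forall>t\<ge>0. p + t *\<^sub>R v \<notin> spectral_region d)"
proof -
  obtain x y where p: "p = (x, y)" by (cases p)
  have ray: ?thesis if "(a, b) \<noteq> 0" "\<And>t. 0 \<le> t \<Longrightarrow> (x + t * a, y + t * b) \<notin> spectral_region d" for a b
    using that by (intro exI[of _ "(a, b)"]) (simp add: p)
  consider "x < y" | "x + 2 * y < d" | "2 * d + 1 < x + y" | "d + 1 < x"
    | "y \<le> x" "d \<le> x + 2 * y" "0 < cubic d x y"
    using assms(3) by (force simp: p spectral_region_def)
  then show ?thesis
  proof cases
    case 1 then show ?thesis by (intro ray[of "-1" 1]) (auto simp: spectral_region_def zero_prod_def)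
  next
    case 2 then show ?thesis by (intro ray[of "-1" "-1"]) (auto simp: spectral_region_def zero_prod_def)
  next
    case 3 then show ?thesis by (intro ray[of 1 1]) (auto simp: spectral_region_def zero_prod_def)
  next
    case 4 then show ?thesis by (intro ray[of 1 0]) (auto simp: spectral_region_def zero_prod_def)
  next
    case 5
    show ?thesis
    proof (rule ray[of 0 1])
      fix t :: real assume "0 \<le> t"
      then have "cubic d x y \<le> cubic d x (y + t)" using 5 assms by (intro cubic_mono) auto
      then show "(x + t * 0, y + t * 1) \<notin> spectral_region d" using 5 by (auto simp: spectral_region_def)
    qed (simp add: zero_prod_def)
  qed
qed

lemma region_P_eq:
  assumes d: "-1/2 < d" "d \<le> 0" "0 \<le> d\<^sup>2 + 3 / 2 * d + 1 / 4"
  shows "region_P d = spectral_region d"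
  unfolding region_P_def path_image_boundary_P[OF d]
proof (rule outline_union_inside)
  have "spectral_region d \<subseteq> {-1..1} \<times> {-1..1}"
    using d by (auto simp: spectral_region_def)
  then show "bounded (spectral_region d)"
    by (rule bounded_subset[rotated]) (intro bounded_Times bounded_closed_interval)
qed (use outline_P_subset[OF d] frontier_spectral_region[OF d] spectral_region_escape[of d] d in auto)

section \<open>The three cases\<close>

theorem theorem2:
  fixes d x y :: real
  assumes "d \<in> {-3/4..0}"
  shows "(d \<in> {-3/4..-1/2} \<longrightarrow>
            (normalized_realizable [1, x, y, d - x - y, - d - 1] \<longleftrightarrow> (x, y) \<in> triangle_ABC d)) \<and>
         (d \<in> {-1/2..-3/4 + sqrt 5 / 4} \<longrightarrow>
            (normalized_realizable [1, x, y, d - x - y, - d - 1] \<longleftrightarrow> (x, y) \<in> quadrangle_ABFG d)) \<and>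
         (d \<in> {-3/4 + sqrt 5 / 4..0} \<longrightarrow>
            (normalized_realizable [1, x, y, d - x - y, - d - 1] \<longleftrightarrow> (x, y) \<in> region_P d))"
proof -
  have d: "-3/4 \<le> d" "d \<le> 0" using assms by auto
  have realizable: "normalized_realizable [1, x, y, d - x - y, - d - 1] \<longleftrightarrow> (x, y) \<in> spectral_region d"
    using d by (intro normalized_realizable_iff_spectral_region) auto
  have sqrt5: "2 < sqrt 5" "sqrt 5 \<le> 3" by (auto intro: real_less_rsqrt real_le_lsqrt)
  have below: "cubic d x y \<le> 0"
    if ord: "y \<le> x" "d \<le> x + 2 * y" "x + y \<le> 2 * d + 1" "x \<le> d + 1" and d_le: "d \<le> -3/4 + sqrt 5 / 4"
  proof (cases "y \<le> 0")
    case True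
    then show ?thesis using ord d by (intro cubic_nonpos_of_y_nonpos) auto
  next
    case False
    have "(d - (-3/4 + sqrt 5 / 4)) * (d - (-3/4 - sqrt 5 / 4)) \<le> 0"
      using d_le d sqrt5 by (intro mult_nonpos_nonneg) auto
    then have "d\<^sup>2 + 3 / 2 * d + 1 / 4 \<le> 0" unfolding g_fun_radicand .
    then show ?thesis using False ord d by (intro cubic_nonpos_of_small_sum) auto
  qed
  have "(x, y) \<in> spectral_region d \<longleftrightarrow> (x, y) \<in> triangle_ABC d" if "d \<in> {-3/4..-1/2}"
    using that below d sqrt5 by (auto simp: triangle_ABC_eq spectral_region_def)
  moreover have "(x, y) \<in> spectral_region d \<longleftrightarrow> (x, y) \<in> quadrangle_ABFG d"
    if "d \<in> {-1/2..-3/4 + sqrt 5 / 4}"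
    using that below d by (auto simp: quadrangle_ABFG_eq spectral_region_def)
  moreover have "spectral_region d = region_P d" if "d \<in> {-3/4 + sqrt 5 / 4..0}"
  proof -
    have "0 \<le> (d - (-3/4 + sqrt 5 / 4)) * (d - (-3/4 - sqrt 5 / 4))"
      using that sqrt5 by (intro mult_nonneg_nonneg) auto
    then have "0 \<le> d\<^sup>2 + 3 / 2 * d + 1 / 4" unfolding g_fun_radicand .
    moreover have "-1/2 < d" using that sqrt5 by auto
    ultimately show ?thesis using d region_P_eq[of d] by blast
  qed
  ultimately show ?thesis using realizable by blast
qed

end
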